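(* Let $n\ge 2$ and let $H_n=k^{C_n}\#kS_{n-1}$ be the bismash product associated with the matched pair $(F,G)=(S_{n-1},C_n)$ arising from the factorization $S_n=S_{n-1}C_n$. Let $V$ be a simple $H_n$-module with character $\chi$. Then the Frobenius-Schur indicator satisfies $\nu(\chi)=1$.
   Context: $k$ is an algebraically closed field of characteristic $0$. All groups are finite. Factorizations: a group $L$ is factorizable into subgroups $F,G$ if every element of $L$ can be written uniquely as $ax$ with $a\in F$, $x\in G$. For $x\in G$, $a\in F$ let $x\rhd a\in F$ and $x\lhd a\in G$ be the unique elements with $xa=(x\rhd a)(x\lhd a)$ in $L$. Then $\rhd$ is a left action of $G$ on the set $F$ and $\lhd$ is a right action of $F$ on the set $G$; $(F,G,\rhd,\lhd)$ is the matched pair arising from $L$. Bismash product: $H=k^G\#kF$ is the Hopf algebra with basis $\{p_x\#a : x\in G, a\in F\}$ (where $\{p_x\}$ is the basis of the dual algebra $k^G$ dual to the elements of $G$), product $(p_x\#a)(p_y\#b)=\delta_{y,\,x\lhd a}\,p_x\#ab$, comultiplication $\Delta(p_x\#a)=\sum_{y\in G}p_{xy^{-1}}\#(y\rhd a)\otimes p_y\#a$, counit $\epsilon(p_x\#a)=\delta_{x,1}$, and antipode $\alpha(p_x\#a)=p_{(x\lhd a)^{-1}}\#(x\rhd a)^{-1}$. It is semisimple. The factorization of $S_n$: $S_{n-1}\subset S_n$ is the subgroup of permutations fixing $n$, and $C_n=\langle z\rangle$ with $z=(1,2,\ldots,n)$. Permutations are composed as functions, right to left. Then $S_n$ is factorizable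 into $F=S_{n-1}$ and $G=C_n$. Frobenius-Schur indicator: for a semisimple Hopf algebra $H$ over $k$, let $\Lambda\in H$ be the unique integral with $\epsilon(\Lambda)=1$, and write $\Delta(\Lambda)=\sum\Lambda_1\otimes\Lambda_2$. For a simple $H$-module with character $\chi$, $\nu(\chi)=\chi\left(\sum\Lambda_1\Lambda_2\right)$. *)

theory Defs
  imports "HOL-Algebra.Algebra" "HOL-Computational_Algebra.Computational_Algebra"
begin

section \<open>Finite-dimensional Hopf algebras presented on a basis\<close>

text \<open>
  The structure maps of a Hopf algebra \<open>H\<close> over \<open>'k\<close> are recorded by their values on a finite
  basis \<open>B\<close>. An element of \<open>H\<close> is its coefficient function \<open>'b \<Rightarrow> 'k\<close>, vanishing off \<open>B\<close>, and
  an element of \<open>H \<otimes> H\<close> is its coefficient function \<open>'b \<times> 'b \<Rightarrow> 'k\<close> with respect to the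
  basis \<open>{b \<otimes> c | b c \<in> B}\<close>.
  The record carries the data only; the Hopf algebra axioms are not imposed.
\<close>

record ('k, 'b) hopf_data =
  hbasis :: "'b set"
  mult_basis :: "'b \<Rightarrow> 'b \<Rightarrow> 'b \<Rightarrow> 'k"
  hunit :: "'b \<Rightarrow> 'k"
  comult_basis :: "'b \<Rightarrow> 'b \<times> 'b \<Rightarrow> 'k"
  counit_basis :: "'b \<Rightarrow> 'k"
  antipode_basis :: "'b \<Rightarrow> 'b \<Rightarrow> 'k"

definition basis_vec :: "'b \<Rightarrow> 'b \<Rightarrow> 'k::field"
  where "basis_vec b = (\<lambda>c. if c = b then 1 else 0)"

definition hcarrier :: "('k::field, 'b) hopf_data \<Rightarrow> ('b \<Rightarrow> 'k) set"
  where "hcarrier H = {h. \<forall>b. b \<notin> hbasis H \<longrightarrow> h b = 0}"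

definition hmult_tensor :: "('k::field, 'b) hopf_data \<Rightarrow> ('b \<times> 'b \<Rightarrow> 'k) \<Rightarrow> 'b \<Rightarrow> 'k"
  where "hmult_tensor H t = (\<lambda>d. \<Sum>b\<in>hbasis H. \<Sum>c\<in>hbasis H. t (b, c) * mult_basis H b c d)"

definition hmult :: "('k::field, 'b) hopf_data \<Rightarrow> ('b \<Rightarrow> 'k) \<Rightarrow> ('b \<Rightarrow> 'k) \<Rightarrow> 'b \<Rightarrow> 'k"
  where "hmult H g h = hmult_tensor H (\<lambda>(b, c). g b * h c)"

definition hcomult :: "('k::field, 'b) hopf_data \<Rightarrow> ('b \<Rightarrow> 'k) \<Rightarrow> 'b \<times> 'b \<Rightarrow> 'k"
  where "hcomult H h = (\<lambda>t. \<Sum>b\<in>hbasis H. h b * comult_basis H b t)"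

definition hcounit :: "('k::field, 'b) hopf_data \<Rightarrow> ('b \<Rightarrow> 'k) \<Rightarrow> 'k"
  where "hcounit H h = (\<Sum>b\<in>hbasis H. h b * counit_basis H b)"

section \<open>Modules and characters\<close>

text \<open>The values of \<open>act\<close> off \<open>hcarrier H\<close> are irrelevant.\<close>

locale hopf_module = vector_space scale
  for scale :: "'k::field \<Rightarrow> 'v::ab_group_add \<Rightarrow> 'v" +
  fixes H :: "('k, 'b) hopf_data"
    and act :: "('b \<Rightarrow> 'k) \<Rightarrow> 'v \<Rightarrow> 'v"
  assumes act_add_right: "h \<in> hcarrier H \<Longrightarrow> act h (u + v) = act h u + act h v"
    and act_scale_right: "h \<in> hcarrier H \<Longrightarrow> act h (scale c v) = scale c (act h v)"
    and act_add_left: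
      "g \<in> hcarrier H \<Longrightarrow> h \<in> hcarrier H \<Longrightarrow> act (\<lambda>b. g b + h b) v = act g v + act h v"
    and act_scale_left: "h \<in> hcarrier H \<Longrightarrow> act (\<lambda>b. c * h b) v = scale c (act h v)"
    and act_mult:
      "g \<in> hcarrier H \<Longrightarrow> h \<in> hcarrier H \<Longrightarrow> act (hmult H g h) v = act g (act h v)"
    and act_unit: "act (hunit H) v = v"
begin

definition submodule :: "'v set \<Rightarrow> bool"
  where "submodule W \<longleftrightarrow> subspace W \<and> (\<forall>h\<in>hcarrier H. \<forall>w\<in>W. act h w \<in> W)"

end

locale simple_hopf_module = hopf_module scale H act
  for scale :: "'k::field \<Rightarrow> 'v::ab_group_add \<Rightarrow> 'v"
    and H :: "('k, 'b) hopf_data"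
    and act :: "('b \<Rightarrow> 'k) \<Rightarrow> 'v \<Rightarrow> 'v" +
  assumes nonzero: "\<exists>v::'v. v \<noteq> 0"
    and simple: "submodule W \<Longrightarrow> W = {0} \<or> W = UNIV"

text \<open>
  The trace does not depend on the chosen basis when the space is finite-dimensional, as is every
  simple module over a finite-dimensional algebra.
\<close>

definition linear_trace :: "('k::field \<Rightarrow> 'v::ab_group_add \<Rightarrow> 'v) \<Rightarrow> ('v \<Rightarrow> 'v) \<Rightarrow> 'k"
  where "linear_trace scale f =
    (let B = (SOME B. \<not> module.dependent scale B \<and> module.span scale B = UNIV)
     in \<Sum>b\<in>B. module.representation scale B (f b) b)"

definition module_character ::
    "('k::field \<Rightarrow> 'v::ab_group_add \<Rightarrow> 'v) \<Rightarrow> (('b \<Rightarrow> 'k) \<Rightarrow> 'v \<Rightarrow> 'v) \<Rightarrow> ('b \<Rightarrow> 'k) \<Rightarrow> 'k"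
  where "module_character scale act h = linear_trace scale (act h)"

section \<open>Integrals and the Frobenius-Schur indicator\<close>

text \<open>Left and right integrals coincide in a semisimple Hopf algebra.\<close>

definition is_integral :: "('k::field, 'b) hopf_data \<Rightarrow> ('b \<Rightarrow> 'k) \<Rightarrow> bool"
  where "is_integral H t \<longleftrightarrow> t \<in> hcarrier H \<and>
    (\<forall>h\<in>hcarrier H. hmult H h t = (\<lambda>b. hcounit H h * t b) \<and>
                     hmult H t h = (\<lambda>b. hcounit H h * t b))"

definition normalized_integral :: "('k::field, 'b) hopf_data \<Rightarrow> 'b \<Rightarrow> 'k"
  where "normalized_integral H = (THE t. is_integral H t \<and> hcounit H t = 1)"

definition fs_indicator :: "('k::field, 'b) hopf_data \<Rightarrow> (('b \<Rightarrow> 'k) \<Rightarrow> 'k) \<Rightarrow> 'k"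
  where "fs_indicator H \<chi> = \<chi> (hmult_tensor H (hcomult H (normalized_integral H)))"

section \<open>Matched pairs and bismash products\<close>

text \<open>
  For a group \<open>L\<close> factorizable into subgroups \<open>F\<close> and \<open>G\<close>, with \<open>x \<in> G\<close> and \<open>a \<in> F\<close>:
  \<open>x \<otimes> a = (x \<rhd> a) \<otimes> (x \<lhd> a)\<close>, where \<open>x \<rhd> a\<close> is \<open>lact L F G x a \<in> F\<close> and \<open>x \<lhd> a\<close> is
  \<open>ract L F G x a \<in> G\<close>.
\<close>

definition lact :: "('a, 'm) monoid_scheme \<Rightarrow> 'a set \<Rightarrow> 'a set \<Rightarrow> 'a \<Rightarrow> 'a \<Rightarrow> 'a"
  where "lact L F G x a = (THE b. b \<in> F \<and> (\<exists>y\<in>G. x \<otimes>\<^bsub>L\<^esub> a = b \<otimes>\<^bsub>L\<^esub> y))"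

definition ract :: "('a, 'm) monoid_scheme \<Rightarrow> 'a set \<Rightarrow> 'a set \<Rightarrow> 'a \<Rightarrow> 'a \<Rightarrow> 'a"
  where "ract L F G x a = (THE y. y \<in> G \<and> (\<exists>b\<in>F. x \<otimes>\<^bsub>L\<^esub> a = b \<otimes>\<^bsub>L\<^esub> y))"

text \<open>The pair \<open>(x, a)\<close> stands for the basis element \<open>p\<^sub>x # a\<close>; the unit is \<open>\<Sum>x\<in>G. p\<^sub>x # 1\<close>.\<close>

definition bismash ::
    "('a, 'm) monoid_scheme \<Rightarrow> 'a set \<Rightarrow> 'a set \<Rightarrow> ('k::field, 'a \<times> 'a) hopf_data"
  where "bismash L F G = \<lparr>
    hbasis = G \<times> F,
    mult_basis = (\<lambda>(x, a) (y, b).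
      if y = ract L F G x a then basis_vec (x, a \<otimes>\<^bsub>L\<^esub> b) else (\<lambda>_. 0)),
    hunit = (\<lambda>c. \<Sum>x\<in>G. basis_vec (x, \<one>\<^bsub>L\<^esub>) c),
    comult_basis = (\<lambda>(x, a) t.
      \<Sum>y\<in>G. basis_vec ((x \<otimes>\<^bsub>L\<^esub> inv\<^bsub>L\<^esub> y, lact L F G y a), (y, a)) t),
    counit_basis = (\<lambda>(x, a). if x = \<one>\<^bsub>L\<^esub> then 1 else 0),
    antipode_basis = (\<lambda>(x, a).
      basis_vec (inv\<^bsub>L\<^esub> (ract L F G x a), inv\<^bsub>L\<^esub> (lact L F G x a))) \<rparr>"

section \<open>The factorization of the symmetric group\<close>

definition point_stabilizer :: "nat \<Rightarrow> (nat \<Rightarrow> nat) set"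
  where "point_stabilizer n = {p \<in> carrier (sym_group n). p n = n}"

definition cyclic_subgroup :: "nat \<Rightarrow> (nat \<Rightarrow> nat) set"
  where "cyclic_subgroup n = generate (sym_group n) {cycle_of_list [1..<Suc n]}"

definition bismash_sym :: "nat \<Rightarrow> ('k::field, (nat \<Rightarrow> nat) \<times> (nat \<Rightarrow> nat)) hopf_data"
  where "bismash_sym n = bismash (sym_group n) (point_stabilizer n) (cyclic_subgroup n)"

end

theory Submission
  imports Defs
begin

text \<open>
  Write \<open>p\<^sub>x\<close> for the idempotent \<open>p\<^sub>x # 1\<close>. A simple module is the direct sum of the spaces \<open>p\<^sub>x V\<close>,
  and the nonzero ones lie over a single orbit of \<open>S\<^sub>n\<^sub>-\<^sub>1\<close> on \<open>C\<^sub>n\<close>. Each of them is an irreducible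
  representation of the stabilizer of \<open>x\<close>, which is the group of all permutations fixing \<open>n\<close> and
  \<open>x\<^sup>-\<^sup>1 n\<close>, that is \<open>S\<^sub>n\<^sub>-\<^sub>1\<close> or \<open>S\<^sub>n\<^sub>-\<^sub>2\<close>. Evaluating \<open>\<Sum>\<Lambda>\<^sub>1 \<Lambda>\<^sub>2\<close> shows that \<open>\<nu>(\<chi>)\<close> is the average of the
  classical indicators of these representations.

  The classical indicator of an irreducible representation \<open>V\<close> of a symmetric group is 1: characters
  are real because \<open>g\<close> is conjugate to \<open>g\<^sup>-\<^sup>1\<close>, so it suffices that \<open>V\<close> carries no nonzero
  skew-symmetric invariant form. As the conjugating element can be chosen to fix a given point \<open>a\<close>,
  the equivariant projection onto an irreducible subrepresentation \<open>U\<close> of the stabilizer of \<open>a\<close> is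
  self-adjoint for any invariant form. By induction a skew-symmetric form vanishes on \<open>U\<close>, so \<open>U\<close> lies
  in its radical, and the form is 0.
\<close>

section \<open>Traces on subspaces\<close>

text \<open>Representations below live on subspaces of one ambient space, because the spaces
  \<open>p\<^sub>x V\<close> of a module are not types of their own.\<close>

locale fd_space = finite_dimensional_vector_space scale Basis
  for scale :: "'k::{alg_closed_field, field_char_0} \<Rightarrow> 'v::ab_group_add \<Rightarrow> 'v" (infixr \<open>*s\<close> 75)
    and Basis :: "'v set"
begin

abbreviation endo :: "('v \<Rightarrow> 'v) \<Rightarrow> bool"
  where "endo \<equiv> Vector_Spaces.linear (*s) (*s)"

abbreviation functional :: "('v \<Rightarrow> 'k) \<Rightarrow> bool"
  where "functional \<equiv> Vector_Spaces.linear (*s) (*)"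

lemma endoI:
  assumes "\<And>u v. f (u + v) = f u + f v" "\<And>c v. f (c *s v) = c *s f v"
  shows "endo f"
  using assms vector_space_axioms by (simp add: Vector_Spaces.linear_iff)

lemma functionalI:
  assumes "\<And>u v. f (u + v) = f u + f v" "\<And>c v. f (c *s v) = c * f v"
  shows "functional f"
proof -
  have "vector_space ((*) :: 'k \<Rightarrow> 'k \<Rightarrow> 'k)"
    by unfold_locales (simp_all add: algebra_simps)
  then show ?thesis using assms vector_space_axioms by (simp add: Vector_Spaces.linear_iff)
qed

lemma endo_add: "endo f \<Longrightarrow> f (u + v) = f u + f v"
  and endo_scale: "endo f \<Longrightarrow> f (c *s v) = c *s f v"
  and functional_add: "functional \<phi> \<Longrightarrow> \<phi> (u + v) = \<phi> u + \<phi> v"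
  and functional_scale: "functional \<phi> \<Longrightarrow> \<phi> (c *s v) = c * \<phi> v"
  by (simp_all add: Vector_Spaces.linear_iff)

lemma endo_zero: "endo f \<Longrightarrow> f 0 = 0"
  and endo_sum: "endo f \<Longrightarrow> f (\<Sum>i\<in>I. g i) = (\<Sum>i\<in>I. f (g i))"
  and functional_zero: "functional \<phi> \<Longrightarrow> \<phi> 0 = 0"
  and functional_sum: "functional \<phi> \<Longrightarrow> \<phi> (\<Sum>i\<in>I. g i) = (\<Sum>i\<in>I. \<phi> (g i))"
  by (simp_all add: linear_iff_module_hom module_hom.zero module_hom.sum)

lemma endo_comp: "endo f \<Longrightarrow> endo g \<Longrightarrow> endo (\<lambda>v. f (g v))"
  by (rule endoI) (simp_all add: endo_add endo_scale)

lemma endo_sum_fun: "(\<And>i. i \<in> I \<Longrightarrow> endo (f i)) \<Longrightarrow> endo (\<lambda>v. \<Sum>i\<in>I. f i v)"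
  by (rule endoI) (simp_all add: endo_add endo_scale sum.distrib scale_sum_right)

lemma functional_sum_fun: "(\<And>i. i \<in> I \<Longrightarrow> functional (f i)) \<Longrightarrow> functional (\<lambda>v. \<Sum>i\<in>I. f i v)"
  by (rule functionalI) (simp_all add: functional_add functional_scale sum.distrib sum_distrib_left)

lemma endo_rank_one: "functional \<phi> \<Longrightarrow> endo (\<lambda>x. \<phi> x *s v)"
  by (rule endoI) (simp_all add: functional_add functional_scale scale_left_distrib)

section \<open>Frames and the trace of an operator on a subspace\<close>

text \<open>Spanning vectors of \<open>W\<close> with coordinate functionals defined on the whole
  space. The condition \<open>\<phi> b b = 1\<close> makes the trace of the identity equal to
  \<open>card B\<close>.\<close>

definition frame :: "'v set \<Rightarrow> 'v set \<Rightarrow> ('v \<Rightarrow> 'v \<Rightarrow> 'k) \<Rightarrow> bool"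
  where "frame W B \<phi> \<longleftrightarrow> finite B \<and> B \<subseteq> W \<and> (\<forall>b\<in>B. functional (\<phi> b) \<and> \<phi> b b = 1) \<and>
    (\<forall>v\<in>W. (\<Sum>b\<in>B. \<phi> b v *s b) = v)"

lemma frameD:
  assumes "frame W B \<phi>"
  shows "finite B" "\<And>b. b \<in> B \<Longrightarrow> b \<in> W" "\<And>b. b \<in> B \<Longrightarrow> functional (\<phi> b)"
    "\<And>b. b \<in> B \<Longrightarrow> \<phi> b b = 1" "\<And>v. v \<in> W \<Longrightarrow> (\<Sum>b\<in>B. \<phi> b v *s b) = v"
  using assms by (auto simp: frame_def)

lemma frame_UNIV_representation:
  assumes "independent B" "span B = UNIV"
  shows "frame UNIV B (\<lambda>b v. representation B v b)"
  using assms finiteI_independent[of B] linear_representation[of B]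
  by (auto simp: frame_def representation_basis intro!: sum_representation_eq)

lemma frame_exists:
  assumes "subspace W"
  obtains B \<phi> where "frame W B \<phi>"
proof -
  obtain B where B: "B \<subseteq> W" "independent B" "W \<subseteq> span B" "finite B"
    using basis_exists finiteI_independent by metis
  let ?E = "extend_basis B"
  have E: "independent ?E" "B \<subseteq> ?E" "span ?E = UNIV"
    using independent_extend_basis[OF B(2)] extend_basis_superset[OF B(2)]
      span_extend_basis[OF B(2)] by auto
  have "(\<Sum>b\<in>B. representation ?E v b *s b) = v" if "v \<in> W" for v
  proof -
    have "representation ?E v = representation B v"
      using representation_extend[OF E(1) _ E(2)] that B(3) by auto
    then show ?thesis
      using sum_representation_eq[OF B(2) _ B(4)] that B(3) by auto
  qed
  then have "frame W B (\<lambda>b v. representation ?E v b)"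
    unfolding frame_def using B E linear_representation[OF E(1,3)]
    by (auto simp: representation_basis)
  then show ?thesis using that by blast
qed

text \<open>Expanding \<open>T b'\<close> in \<open>B\<close> and then \<open>b\<close> in
  \<open>B'\<close> is the usual argument for cyclicity of the trace. Equal subspaces give
  independence of the frame; \<open>W' = UNIV\<close> lets an operator with image in
  \<open>W\<close> be traced on \<open>W\<close> alone.\<close>

lemma trace_frames:
  assumes fr: "frame W B \<phi>" and fr': "frame W' B' \<psi>" and T: "endo T"
    and sub: "W \<subseteq> W'" and im: "\<And>w. w \<in> W' \<Longrightarrow> T w \<in> W"
  shows "(\<Sum>b\<in>B'. \<psi> b (T b)) = (\<Sum>b\<in>B. \<phi> b (T b))"
proof -
  have "\<psi> b' (T b') = (\<Sum>b\<in>B. \<phi> b (T b') * \<psi> b' b)" if "b' \<in> B'" for b'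
  proof -
    have "T b' = (\<Sum>b\<in>B. \<phi> b (T b') *s b)"
      using frameD(5)[OF fr, of "T b'"] im[OF frameD(2)[OF fr' that]] by simp
    then have "\<psi> b' (T b') = \<psi> b' (\<Sum>b\<in>B. \<phi> b (T b') *s b)"
      by simp
    then show ?thesis
      using frameD(3)[OF fr' that] by (simp add: functional_sum functional_scale)
  qed
  then have "(\<Sum>b\<in>B'. \<psi> b (T b)) = (\<Sum>b'\<in>B'. \<Sum>b\<in>B. \<phi> b (T b') * \<psi> b' b)"
    by simp
  also have "\<dots> = (\<Sum>b\<in>B. \<Sum>b'\<in>B'. \<phi> b (T b') * \<psi> b' b)"
    by (rule sum.swap)
  also have "\<dots> = (\<Sum>b\<in>B. \<phi> b (T b))"
  proof (rule sum.cong[OF refl])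
    fix b assume b: "b \<in> B"
    have "b = (\<Sum>b'\<in>B'. \<psi> b' b *s b')"
      using frameD(5)[OF fr', of b] frameD(2)[OF fr b] sub by auto
    then have "\<phi> b (T b) = \<phi> b (T (\<Sum>b'\<in>B'. \<psi> b' b *s b'))"
      by simp
    also have "\<dots> = (\<Sum>b'\<in>B'. \<psi> b' b * \<phi> b (T b'))"
      using frameD(3)[OF fr b] T by (simp add: functional_sum functional_scale endo_sum endo_scale)
    finally show "(\<Sum>b'\<in>B'. \<phi> b (T b') * \<psi> b' b) = \<phi> b (T b)"
      by (simp add: mult.commute)
  qed
  finally show ?thesis .
qed

definition trace_on :: "'v set \<Rightarrow> ('v \<Rightarrow> 'v) \<Rightarrow> 'k"
  where "trace_on W T = (SOME t. \<exists>B \<phi>. frame W B \<phi> \<and> t = (\<Sum>b\<in>B. \<phi> b (T b)))"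

lemma trace_on_eq:
  assumes "frame W B \<phi>" "endo T" "\<And>w. w \<in> W \<Longrightarrow> T w \<in> W"
  shows "trace_on W T = (\<Sum>b\<in>B. \<phi> b (T b))"
  unfolding trace_on_def
proof (rule some_equality)
  show "\<exists>B' \<phi>'. frame W B' \<phi>' \<and> (\<Sum>b\<in>B. \<phi> b (T b)) = (\<Sum>b\<in>B'. \<phi>' b (T b))"
    using assms(1) by blast
  show "t = (\<Sum>b\<in>B. \<phi> b (T b))" if "\<exists>B \<phi>. frame W B \<phi> \<and> t = (\<Sum>b\<in>B. \<phi> b (T b))" for t
    using that trace_frames[OF assms(1) _ assms(2) order_refl assms(3)] by auto
qed

text \<open>A frame evaluates the operator only at elements of \<open>W\<close>, so the two choices
  are made from the same set of values.\<close>

lemma trace_on_cong: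
  assumes "\<And>w. w \<in> W \<Longrightarrow> S w = T w"
  shows "trace_on W S = trace_on W T"
proof -
  have "(\<Sum>b\<in>B. \<phi> b (S b)) = (\<Sum>b\<in>B. \<phi> b (T b))" if "frame W B \<phi>" for B \<phi>
    using frameD(2)[OF that] assms by simp
  then show ?thesis unfolding trace_on_def by metis
qed

lemma trace_on_comp_commute:
  assumes W: "subspace W" and S: "endo S" "\<And>w. w \<in> W \<Longrightarrow> S w \<in> W"
    and T: "endo T" "\<And>w. w \<in> W \<Longrightarrow> T w \<in> W"
  shows "trace_on W (\<lambda>v. S (T v)) = trace_on W (\<lambda>v. T (S v))"
proof -
  obtain B \<phi> where fr: "frame W B \<phi>" using frame_exists[OF W] .
  have expand: "(\<Sum>b\<in>B. \<phi> b (S (T b))) = (\<Sum>b\<in>B. \<Sum>c\<in>B. \<phi> c (T b) * \<phi> b (S c))"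
    if S: "endo S" "\<And>w. w \<in> W \<Longrightarrow> S w \<in> W" and T: "\<And>w. w \<in> W \<Longrightarrow> T w \<in> W" for S T
  proof (rule sum.cong[OF refl])
    fix b assume b: "b \<in> B"
    have "\<phi> b (S (T b)) = \<phi> b (S (\<Sum>c\<in>B. \<phi> c (T b) *s c))"
      using frameD(5)[OF fr, of "T b"] T frameD(2)[OF fr b] by simp
    then show "\<phi> b (S (T b)) = (\<Sum>c\<in>B. \<phi> c (T b) * \<phi> b (S c))"
      using frameD(3)[OF fr b] S(1) by (simp add: functional_sum functional_scale endo_sum endo_scale)
  qed
  have "trace_on W (\<lambda>v. S (T v)) = (\<Sum>b\<in>B. \<Sum>c\<in>B. \<phi> c (T b) * \<phi> b (S c))"
    using trace_on_eq[OF fr endo_comp[OF S(1) T(1)]] expand[OF S T(2)] S T by simp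
  also have "\<dots> = (\<Sum>b\<in>B. \<Sum>c\<in>B. \<phi> c (S b) * \<phi> b (T c))"
    by (subst sum.swap) (simp add: mult.commute)
  also have "\<dots> = trace_on W (\<lambda>v. T (S v))"
    using trace_on_eq[OF fr endo_comp[OF T(1) S(1)]] expand[OF T S(2)] S T by simp
  finally show ?thesis .
qed

lemma trace_on_sum:
  assumes W: "subspace W" and T: "\<And>i. i \<in> I \<Longrightarrow> endo (T i)" "\<And>i w. i \<in> I \<Longrightarrow> w \<in> W \<Longrightarrow> T i w \<in> W"
  shows "trace_on W (\<lambda>v. \<Sum>i\<in>I. T i v) = (\<Sum>i\<in>I. trace_on W (T i))"
proof -
  obtain B \<phi> where fr: "frame W B \<phi>" using frame_exists[OF W] .
  have "trace_on W (\<lambda>v. \<Sum>i\<in>I. T i v) = (\<Sum>b\<in>B. \<Sum>i\<in>I. \<phi> b (T i b))"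
    by (subst trace_on_eq[OF fr endo_sum_fun[of I T, OF T(1)]])
      (use T(2) subspace_sum[OF W, of I] frameD(3)[OF fr] in \<open>auto simp: functional_sum\<close>)
  then show ?thesis
    using trace_on_eq[OF fr T(1)] T by (subst (asm) sum.swap) simp
qed

lemma trace_on_scale:
  assumes W: "subspace W" and T: "endo T" "\<And>w. w \<in> W \<Longrightarrow> T w \<in> W"
  shows "trace_on W (\<lambda>v. c *s T v) = c * trace_on W T"
proof -
  obtain B \<phi> where fr: "frame W B \<phi>" using frame_exists[OF W] .
  have "endo (\<lambda>v. c *s T v)" by (rule endo_comp[OF linear_scale_self T(1)])
  then show ?thesis
    using trace_on_eq[OF fr, of "\<lambda>v. c *s T v"] trace_on_eq[OF fr T] T(2) subspace_scale[OF W] frameD(3)[OF fr]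
    by (simp add: functional_scale sum_distrib_left)
qed

text \<open>\<open>d\<close> is the dimension of \<open>W\<close>, counted as the size of a frame;
  characteristic 0 keeps it nonzero in the field.\<close>

lemma trace_on_scalar:
  assumes W: "subspace W" "W \<noteq> {0}"
  obtains d :: 'k where "d \<noteq> 0" "\<And>c. trace_on W (\<lambda>v. c *s v) = c * d"
proof -
  obtain B \<phi> where fr: "frame W B \<phi>" using frame_exists[OF W(1)] .
  have "trace_on W (\<lambda>v. c *s v) = c * of_nat (card B)" for c
    using trace_on_eq[OF fr linear_scale_self] frameD(3,4)[OF fr] subspace_scale[OF W(1)]
    by (simp add: functional_scale mult.commute)
  moreover have "B \<noteq> {}"
  proof
    assume "B = {}"
    then have "v = 0" if "v \<in> W" for v using frameD(5)[OF fr that] by simp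
    then show False using W subspace_0 by blast
  qed
  then have "of_nat (card B) \<noteq> (0 :: 'k)" using frameD(1)[OF fr] by simp
  ultimately show ?thesis using that by blast
qed

lemma trace_on_rank_one:
  assumes W: "subspace W" "v \<in> W" and \<phi>: "functional \<phi>"
  shows "trace_on W (\<lambda>x. \<phi> x *s v) = \<phi> v"
proof -
  obtain B \<psi> where fr: "frame W B \<psi>" using frame_exists[OF W(1)] .
  have "trace_on W (\<lambda>x. \<phi> x *s v) = (\<Sum>b\<in>B. \<phi> (\<psi> b v *s b))"
    using trace_on_eq[OF fr endo_rank_one[OF \<phi>]] frameD(3)[OF fr] subspace_scale[OF W(1)] W(2) \<phi>
    by (simp add: functional_scale mult.commute)
  also have "\<dots> = \<phi> v"
    by (subst functional_sum[OF \<phi>, symmetric]) (simp add: frameD(5)[OF fr W(2)])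
  finally show ?thesis .
qed

text \<open>Connects the trace by which characters are defined with traces on subspaces: the basis
  chosen in \<open>linear_trace\<close> yields a frame of the whole space.\<close>

lemma linear_trace_eq_trace_on:
  assumes W: "subspace W" and T: "endo T" "\<And>v. T v \<in> W"
  shows "linear_trace (*s) T = trace_on W T"
proof -
  define B where "B = (SOME B. \<not> dependent B \<and> span B = UNIV)"
  have "independent B \<and> span B = UNIV"
    unfolding B_def by (rule someI[of _ Basis]) (simp add: independent_Basis span_Basis)
  then have fr': "frame UNIV B (\<lambda>b v. representation B v b)"
    using frame_UNIV_representation by blast
  obtain C \<phi> where fr: "frame W C \<phi>" using frame_exists[OF W] .
  show ?thesis
    using trace_frames[OF fr fr' T(1)] trace_on_eq[OF fr T(1)] T(2)
    by (simp add: linear_trace_def B_def Let_def)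
qed

section \<open>Eigenvectors from annihilating polynomials\<close>

definition poly_op :: "'k poly \<Rightarrow> ('v \<Rightarrow> 'v) \<Rightarrow> 'v \<Rightarrow> 'v"
  where "poly_op p T v = (\<Sum>i\<le>degree p. coeff p i *s (T ^^ i) v)"

lemma poly_op_altdef:
  assumes "degree p \<le> m"
  shows "poly_op p T v = (\<Sum>i\<le>m. coeff p i *s (T ^^ i) v)"
  unfolding poly_op_def
  by (rule sum.mono_neutral_left) (use assms in \<open>auto simp: coeff_eq_0\<close>)

lemma poly_op_linear_factor:
  assumes "endo T"
  shows "poly_op ([:- c, 1:] * q) T v = T (poly_op q T v) - c *s poly_op q T v"
proof -
  let ?m = "Suc (degree q)"
  have deg: "degree ([:- c, 1:] * q) \<le> ?m"
    using degree_mult_le[of "[:- c, 1:]" q] by simp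
  have "poly_op ([:- c, 1:] * q) T v = (\<Sum>i\<le>?m. coeff (pCons 0 q) i *s (T ^^ i) v - (c * coeff q i) *s (T ^^ i) v)"
    unfolding poly_op_altdef[OF deg]
    by (rule sum.cong) (simp_all add: scale_left_distrib scale_left_diff_distrib[symmetric])
  also have "\<dots> = (\<Sum>i\<le>?m. coeff (pCons 0 q) i *s (T ^^ i) v) - (\<Sum>i\<le>?m. (c * coeff q i) *s (T ^^ i) v)"
    by (rule sum_subtractf)
  also have "(\<Sum>i\<le>?m. coeff (pCons 0 q) i *s (T ^^ i) v) = T (poly_op q T v)"
    unfolding sum.atMost_Suc_shift by (simp add: poly_op_def endo_sum[OF assms] endo_scale[OF assms])
  also have "(\<Sum>i\<le>?m. (c * coeff q i) *s (T ^^ i) v) = c *s poly_op q T v"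
    by (simp add: poly_op_altdef[of q ?m] scale_sum_right coeff_eq_0)
  finally show ?thesis .
qed

lemma poly_op_in_subspace:
  assumes "subspace W" "v \<in> W" "\<And>w. w \<in> W \<Longrightarrow> T w \<in> W"
  shows "poly_op p T v \<in> W"
proof -
  have "(T ^^ i) v \<in> W" for i by (induction i) (use assms in auto)
  then show ?thesis
    unfolding poly_op_def by (intro subspace_sum subspace_scale assms) auto
qed

text \<open>The \<open>m + 1\<close> vectors \<open>v, T v, ..., T^m v\<close> in a space of
  dimension \<open>m\<close> satisfy a nontrivial linear relation, whose coefficients are those of
  \<open>p\<close>.\<close>

lemma annihilating_poly_exists: "\<exists>p. p \<noteq> 0 \<and> poly_op p T v = 0"
proof -
  define m where "m = dim (UNIV :: 'v set)"
  define t where "t i = (T ^^ i) v" for i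
  have pow: "poly_op (\<Sum>i\<le>m. monom (u i) i) T v = (\<Sum>i\<le>m. u i *s t i)" for u
  proof -
    have co: "coeff (\<Sum>i\<le>m. monom (u i) i) j = (if j \<le> m then u j else 0)" for j
      by (simp add: coeff_sum)
    have "degree (\<Sum>i\<le>m. monom (u i) i) \<le> m"
      by (rule degree_le) (simp add: co)
    from poly_op_altdef[OF this] show ?thesis
      by (simp add: co t_def)
  qed
  have nz: "(\<Sum>i\<le>m. monom (u i) i) \<noteq> 0" if "j \<le> m" "u j \<noteq> 0" for u :: "nat \<Rightarrow> 'k" and j
  proof -
    have "coeff (\<Sum>i\<le>m. monom (u i) i) j = u j" using that by (simp add: coeff_sum)
    then show ?thesis using that by auto
  qed
  \<comment> \<open>Linear dependence is a property of sets, so a repetition among the vectors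
    \<open>t i\<close> has to be treated apart; there the relation is
    \<open>t i - t j = 0\<close>.\<close>
  show ?thesis
  proof (cases "inj_on t {..m}")
    case True
    then have "card (t ` {..m}) = Suc m" by (simp add: card_image)
    then have "dependent (t ` {..m})"
      using independent_card_le_dim[of "t ` {..m}" UNIV] m_def by auto
    then obtain u w where u: "w \<in> t ` {..m}" "u w \<noteq> 0" "(\<Sum>w\<in>t ` {..m}. u w *s w) = 0"
      using dependent_finite[of "t ` {..m}"] by auto
    then obtain j where j: "j \<le> m" "w = t j" by auto
    have "(\<Sum>i\<le>m. u (t i) *s t i) = 0"
      using u(3) by (simp add: sum.reindex[OF True])
    then have "poly_op (\<Sum>i\<le>m. monom (u (t i)) i) T v = 0" by (simp only: pow)
    moreover have "(\<Sum>i\<le>m. monom (u (t i)) i) \<noteq> 0"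
      by (rule nz[of j]) (use j u(2) in auto)
    ultimately show ?thesis by blast
  next
    case False
    then obtain i j where ij: "i \<le> m" "j \<le> m" "i \<noteq> j" "t i = t j"
      by (auto simp: inj_on_def)
    define u :: "nat \<Rightarrow> 'k" where "u l = (if l = i then 1 else if l = j then -1 else 0)" for l
    have "(\<Sum>l\<le>m. u l *s t l) = (\<Sum>l\<in>{i, j}. u l *s t l)"
      by (rule sum.mono_neutral_right) (use ij in \<open>auto simp: u_def\<close>)
    also have "\<dots> = 0" using ij by (simp add: u_def)
    finally have "poly_op (\<Sum>l\<le>m. monom (u l) l) T v = 0" by (simp only: pow)
    moreover have "(\<Sum>l\<le>m. monom (u l) l) \<noteq> 0"
      by (rule nz[of i]) (use ij in \<open>auto simp: u_def\<close>)
    ultimately show ?thesis by blast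
  qed
qed

text \<open>Among all nonzero polynomials annihilating some nonzero vector of \<open>W\<close>, take
  one of least degree and split off a root: \<open>p = (X - c) q\<close>. By minimality
  \<open>q(T) v\<close> is nonzero, and \<open>T - c\<close> kills it.\<close>

lemma eigenvector_exists:
  assumes W: "subspace W" "W \<noteq> {0}" and T: "endo T" "\<And>w. w \<in> W \<Longrightarrow> T w \<in> W"
  obtains c w where "w \<in> W" "w \<noteq> 0" "T w = c *s w"
proof -
  let ?P = "\<lambda>n. \<exists>p v. p \<noteq> 0 \<and> degree p = n \<and> v \<in> W \<and> v \<noteq> 0 \<and> poly_op p T v = 0"
  obtain v0 where v0: "v0 \<in> W" "v0 \<noteq> 0" using W subspace_0 by blast
  obtain p0 where "p0 \<noteq> 0" "poly_op p0 T v0 = 0" using annihilating_poly_exists by blast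
  then have ex: "\<exists>n. ?P n" using v0 by blast
  define n where "n = (LEAST n. ?P n)"
  obtain p v where p: "p \<noteq> 0" "degree p = n" "v \<in> W" "v \<noteq> 0" "poly_op p T v = 0"
    using LeastI_ex[OF ex] unfolding n_def by blast
  have min: "\<not> ?P k" if "k < n" for k using that not_less_Least unfolding n_def by blast
  have "degree p > 0"
  proof (rule ccontr)
    assume "\<not> degree p > 0"
    then have "coeff p 0 *s v = 0" using p(5) by (simp add: poly_op_def)
    then show False using p(1,4) \<open>\<not> degree p > 0\<close> by (metis leading_coeff_0_iff neq0_conv scale_eq_0_iff)
  qed
  then obtain c where "poly p c = 0" using alg_closed_imp_poly_has_root by blast
  then obtain q where q: "p = [:- c, 1:] * q" by (metis poly_eq_0_iff_dvd dvdE)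
  then have "q \<noteq> 0" using p(1) by auto
  then have "degree q < n"
    using p(2) q by (simp add: degree_mult_eq del: mult_pCons_left)
  then have "poly_op q T v \<noteq> 0" using min \<open>q \<noteq> 0\<close> p(3,4) by blast
  moreover have "T (poly_op q T v) = c *s poly_op q T v"
    using poly_op_linear_factor[OF T(1), of c q v] p(5) q by simp
  moreover have "poly_op q T v \<in> W" by (rule poly_op_in_subspace) (use W p T in auto)
  ultimately show ?thesis using that by blast
qed

end

section \<open>Representations of finite groups\<close>

text \<open>The homomorphism laws are imposed on \<open>W\<close> only. In the application
  \<open>R \<one>\<close> is the projection onto a component of a module, which is the identity
  there but not on the whole space.\<close>

locale group_rep = fd_space scale Basis + group G
  for scale :: "'k::{alg_closed_field, field_char_0} \<Rightarrow> 'v::ab_group_add \<Rightarrow> 'v" (infixr \<open>*s\<close> 75)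
    and Basis :: "'v set" and G :: "('g, 'm) monoid_scheme" (structure) +
  fixes R :: "'g \<Rightarrow> 'v \<Rightarrow> 'v" and W :: "'v set"
  assumes finite_carrier: "finite (carrier G)"
    and subspace_W: "subspace W"
    and endo_R: "g \<in> carrier G \<Longrightarrow> endo (R g)"
    and R_in: "g \<in> carrier G \<Longrightarrow> w \<in> W \<Longrightarrow> R g w \<in> W"
    and R_mult: "g \<in> carrier G \<Longrightarrow> h \<in> carrier G \<Longrightarrow> w \<in> W \<Longrightarrow> R (g \<otimes> h) w = R g (R h w)"
    and R_one: "w \<in> W \<Longrightarrow> R \<one> w = w"
begin

definition invariant :: "'v set \<Rightarrow> bool"
  where "invariant U \<longleftrightarrow> subspace U \<and> U \<subseteq> W \<and> (\<forall>g\<in>carrier G. \<forall>u\<in>U. R g u \<in> U)"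

lemma R_inv_R: "g \<in> carrier G \<Longrightarrow> w \<in> W \<Longrightarrow> R (inv g) (R g w) = w"
  and R_R_inv: "g \<in> carrier G \<Longrightarrow> w \<in> W \<Longrightarrow> R g (R (inv g) w) = w"
  by (simp_all add: R_mult[symmetric] R_one)

lemma sum_mult_left:
  assumes "h \<in> carrier G"
  shows "(\<Sum>g\<in>carrier G. f (h \<otimes> g)) = (\<Sum>g\<in>carrier G. f g)"
  by (rule sum.reindex_bij_witness[of _ "\<lambda>g. inv h \<otimes> g" "\<lambda>g. h \<otimes> g"])
    (use assms in \<open>simp_all add: m_assoc[symmetric]\<close>)

lemma sum_mult_right:
  assumes "h \<in> carrier G"
  shows "(\<Sum>g\<in>carrier G. f (g \<otimes> h)) = (\<Sum>g\<in>carrier G. f g)"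
  by (rule sum.reindex_bij_witness[of _ "\<lambda>g. g \<otimes> inv h" "\<lambda>g. g \<otimes> h"])
    (use assms in \<open>simp_all add: m_assoc\<close>)

lemma sum_inverse: "(\<Sum>g\<in>carrier G. f (inv g)) = (\<Sum>g\<in>carrier G. f g)"
  by (rule sum.reindex_bij_witness[of _ "\<lambda>g. inv g" "\<lambda>g. inv g"]) simp_all

lemma card_carrier_ne_0: "of_nat (card (carrier G)) \<noteq> (0 :: 'k)"
  using finite_carrier one_closed by auto

text \<open>Replacing the summation index \<open>g\<close> by \<open>h \<otimes> g\<close> moves
  \<open>R h\<close> out of the sum of conjugates.\<close>

lemma average_equivariant:
  assumes T: "endo T" "\<And>w. w \<in> W \<Longrightarrow> T w \<in> W" and h: "h \<in> carrier G" and w: "w \<in> W"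
  shows "(\<Sum>g\<in>carrier G. R g (T (R (inv g) (R h w)))) =
    R h (\<Sum>g\<in>carrier G. R g (T (R (inv g) w)))"
proof -
  have "(\<Sum>g\<in>carrier G. R g (T (R (inv g) (R h w)))) =
      (\<Sum>g\<in>carrier G. R (h \<otimes> g) (T (R (inv (h \<otimes> g)) (R h w))))"
    by (rule sum_mult_left[OF h, symmetric])
  also have "\<dots> = (\<Sum>g\<in>carrier G. R h (R g (T (R (inv g) w))))"
    by (rule sum.cong) (use h w T in \<open>simp_all add: inv_mult_group R_mult R_in R_inv_R\<close>)
  finally show ?thesis by (simp add: endo_sum[OF endo_R[OF h]])
qed

lemma subrep:
  assumes "invariant U"
  shows "group_rep (*s) Basis G R U"
proof (intro group_rep.intro group_rep_axioms.intro)
  have U: "subspace U" "U \<subseteq> W" "\<And>g u. g \<in> carrier G \<Longrightarrow> u \<in> U \<Longrightarrow> R g u \<in> U"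
    using assms by (simp_all add: invariant_def)
  fix g h u assume "g \<in> carrier G" "h \<in> carrier G" "u \<in> U"
  then show "R (g \<otimes> h) u = R g (R h u)" using R_mult U(2) by blast
next
  fix g u assume "g \<in> carrier G" "u \<in> U"
  then show "R g u \<in> U" using assms by (simp add: invariant_def)
next
  fix u assume "u \<in> U"
  then show "R \<one> u = u" using R_one assms by (auto simp: invariant_def)
qed (use assms in \<open>auto simp: invariant_def fd_space_axioms group_axioms finite_carrier endo_R\<close>)

lemma restrict_subgroup:
  assumes "subgroup K G"
  shows "group_rep (*s) Basis (G\<lparr>carrier := K\<rparr>) R W"
proof -
  have KG: "k \<in> carrier G" if "k \<in> K" for k using that subgroup.mem_carrier[OF assms] by blast
  have "finite K" using finite_subset[OF subgroup.subset[OF assms] finite_carrier] .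
  moreover have "group (G\<lparr>carrier := K\<rparr>)" using assms by (rule subgroup_imp_group)
  ultimately show ?thesis
    by (intro group_rep.intro group_rep_axioms.intro)
      (simp_all add: KG fd_space_axioms subspace_W endo_R R_in R_mult R_one)
qed

text \<open>Maschke's theorem, in the form of an equivariant projection: any linear projection onto
  \<open>U\<close>, here the one given by a frame, is averaged over the group.\<close>

lemma invariant_complement:
  assumes "invariant U"
  obtains \<pi> where "endo \<pi>" "\<And>w. w \<in> W \<Longrightarrow> \<pi> w \<in> U" "\<And>u. u \<in> U \<Longrightarrow> \<pi> u = u"
    "\<And>g w. g \<in> carrier G \<Longrightarrow> w \<in> W \<Longrightarrow> \<pi> (R g w) = R g (\<pi> w)"
proof -
  have U: "subspace U" "U \<subseteq> W" "\<And>g u. g \<in> carrier G \<Longrightarrow> u \<in> U \<Longrightarrow> R g u \<in> U"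
    using assms by (auto simp: invariant_def)
  obtain B \<phi> where fr: "frame U B \<phi>" using frame_exists[OF U(1)] .
  define P where "P v = (\<Sum>b\<in>B. \<phi> b v *s b)" for v
  have P: "endo P" unfolding P_def by (intro endo_sum_fun endo_rank_one frameD(3)[OF fr])
  have P_in: "P v \<in> U" for v
    unfolding P_def by (intro subspace_sum[OF U(1)] subspace_scale[OF U(1)] frameD(2)[OF fr])
  have P_id: "P u = u" if "u \<in> U" for u
    unfolding P_def using frameD(5)[OF fr that] .
  define S where "S v = (\<Sum>g\<in>carrier G. R g (P (R (inv g) v)))" for v
  define c :: 'k where "c = inverse (of_nat (card (carrier G)))"
  define \<pi> where "\<pi> v = c *s S v" for v
  have "endo S" unfolding S_def
    by (intro endo_sum_fun endo_comp[of "R _" "\<lambda>v. P (R (inv _) v)"] endo_comp[OF P] endo_R inv_closed)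
  then have 1: "endo \<pi>" unfolding \<pi>_def
    by (intro endoI) (simp_all add: endo_add endo_scale scale_right_distrib mult.commute)
  have 2: "\<pi> w \<in> U" for w
    unfolding \<pi>_def S_def by (intro subspace_scale subspace_sum U P_in)
  have 3: "\<pi> u = u" if u: "u \<in> U" for u
  proof -
    have "R g (P (R (inv g) u)) = u" if "g \<in> carrier G" for g
      using that u U(2) by (subst P_id) (auto intro: U(3) simp: R_R_inv)
    then have "S u = of_nat (card (carrier G)) *s u"
      by (simp add: S_def sum_constant_scale)
    then show ?thesis using card_carrier_ne_0 by (simp add: \<pi>_def c_def)
  qed
  have 4: "\<pi> (R g w) = R g (\<pi> w)" if "g \<in> carrier G" "w \<in> W" for g w
    using average_equivariant[OF P _ that] P_in U(2) that(1)
    by (auto simp: \<pi>_def S_def endo_scale[OF endo_R])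
  show ?thesis using that 1 2 3 4 by blast
qed

end

locale irreducible_rep = group_rep +
  assumes nontrivial: "W \<noteq> {0}"
    and irreducible: "invariant U \<Longrightarrow> U = {0} \<or> U = W"

context group_rep
begin

text \<open>A nonzero invariant subspace of least dimension is irreducible.\<close>

lemma irreducible_subrep_exists:
  assumes "W \<noteq> {0}"
  obtains U where "invariant U" "irreducible_rep (*s) Basis G R U"
proof -
  let ?P = "\<lambda>n. \<exists>U. invariant U \<and> U \<noteq> {0} \<and> dim U = n"
  have "invariant W" using subspace_W R_in by (auto simp: invariant_def)
  then have ex: "\<exists>n. ?P n" using assms by blast
  obtain U where U: "invariant U" "U \<noteq> {0}" "dim U = (LEAST n. ?P n)"
    using LeastI_ex[OF ex] by blast
  interpret U: group_rep "(*s)" Basis G R U using subrep[OF U(1)] .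
  have "irreducible_rep (*s) Basis G R U"
  proof
    show "U \<noteq> {0}" by fact
    fix T assume T: "U.invariant T"
    then have T': "invariant T" "T \<subseteq> U" "subspace T"
      using U(1) by (auto simp: invariant_def U.invariant_def)
    show "T = {0} \<or> T = U"
    proof (cases "T = {0}")
      case False
      then have "dim U \<le> dim T" unfolding U(3) using T'(1) by (intro Least_le) blast
      then show ?thesis
        using subspace_dim_equal[OF T'(3) U.subspace_W T'(2)] by simp
    qed simp
  qed
  then show ?thesis using that U(1) by blast
qed

end

section \<open>Schur's lemma and orthogonality relations\<close>

context irreducible_rep
begin

text \<open>An eigenspace of \<open>T\<close> inside \<open>W\<close> is invariant and nonzero,
  hence all of \<open>W\<close>.\<close>

lemma schur:
  assumes T: "endo T" "\<And>w. w \<in> W \<Longrightarrow> T w \<in> W"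
    and eq: "\<And>g w. g \<in> carrier G \<Longrightarrow> w \<in> W \<Longrightarrow> T (R g w) = R g (T w)"
  obtains c where "\<And>w. w \<in> W \<Longrightarrow> T w = c *s w"
proof -
  obtain c w where w: "w \<in> W" "w \<noteq> 0" "T w = c *s w"
    using eigenvector_exists[OF subspace_W nontrivial T] .
  let ?U = "{w \<in> W. T w = c *s w}"
  have "invariant ?U"
    unfolding invariant_def using subspace_W T eq R_in
    by (auto simp: subspace_def endo_zero endo_add endo_scale endo_R scale_right_distrib mult.commute)
  then have "?U = W" using irreducible w by blast
  then show ?thesis using that by blast
qed

text \<open>The sum of the conjugates of the rank-one operator
  \<open>x \<mapsto> \<phi> x *s v\<close> is a scalar by Schur's lemma. Each conjugate has trace
  \<open>\<phi> v\<close>, so the scalar is \<open>\<kappa> * \<phi> v\<close> with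
  \<open>\<kappa>\<close> the group order divided by \<open>d = dim W\<close>.\<close>

lemma schur_orthogonality:
  obtains d \<kappa> where "d \<noteq> 0" "\<kappa> * d = of_nat (card (carrier G))" "\<And>c. trace_on W (\<lambda>v. c *s v) = c * d"
    "\<And>\<phi> u v. functional \<phi> \<Longrightarrow> u \<in> W \<Longrightarrow> v \<in> W \<Longrightarrow>
      (\<Sum>g\<in>carrier G. \<phi> (R (inv g) u) *s R g v) = (\<kappa> * \<phi> v) *s u"
proof -
  obtain d where d: "d \<noteq> 0" "\<And>c. trace_on W (\<lambda>v. c *s v) = c * d"
    using trace_on_scalar[OF subspace_W nontrivial] by blast
  define \<kappa> where "\<kappa> = of_nat (card (carrier G)) / d"
  have "(\<Sum>g\<in>carrier G. \<phi> (R (inv g) u) *s R g v) = (\<kappa> * \<phi> v) *s u"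
    if \<phi>: "functional \<phi>" and u: "u \<in> W" and v: "v \<in> W" for \<phi> u v
  proof -
    define Y where "Y x = \<phi> x *s v" for x
    have Y: "endo Y" "\<And>w. Y w \<in> W"
      unfolding Y_def using endo_rank_one[OF \<phi>] subspace_scale[OF subspace_W v] by auto
    have Z: "endo (\<lambda>x. R g (Y (R (inv g) x)))" if "g \<in> carrier G" for g
      using that by (intro endo_comp[of "R g" "\<lambda>x. Y (R (inv g) x)"] endo_comp[OF Y(1)] endo_R inv_closed)
    define T where "T x = (\<Sum>g\<in>carrier G. R g (Y (R (inv g) x)))" for x
    have T: "endo T" "\<And>w. T w \<in> W"
      unfolding T_def using Z by (auto intro!: endo_sum_fun subspace_sum[OF subspace_W] R_in Y)
    have equi: "T (R g w) = R g (T w)" if "g \<in> carrier G" "w \<in> W" for g w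
      unfolding T_def by (rule average_equivariant[OF Y that])
    obtain c where c: "\<And>w. w \<in> W \<Longrightarrow> T w = c *s w"
      using schur[OF T equi] by blast
    have tr: "trace_on W (\<lambda>x. R g (Y (R (inv g) x))) = \<phi> v" if g: "g \<in> carrier G" for g
    proof -
      have "trace_on W (\<lambda>x. R g (Y (R (inv g) x))) = trace_on W (\<lambda>x. Y (R (inv g) (R g x)))"
        by (rule trace_on_comp_commute[OF subspace_W, of "R g" "\<lambda>x. Y (R (inv g) x)"])
          (use g Y in \<open>simp_all add: endo_R R_in endo_comp[OF Y(1) endo_R]\<close>)
      also have "\<dots> = trace_on W Y"
        by (rule trace_on_cong) (use g in \<open>simp add: R_inv_R\<close>)
      also have "\<dots> = \<phi> v"
        unfolding Y_def by (rule trace_on_rank_one[OF subspace_W v \<phi>])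
      finally show ?thesis .
    qed
    have "c * d = trace_on W T"
      using d(2)[of c] trace_on_cong[of W T "\<lambda>w. c *s w"] c by simp
    also have "\<dots> = (\<Sum>g\<in>carrier G. trace_on W (\<lambda>x. R g (Y (R (inv g) x))))"
      unfolding T_def by (rule trace_on_sum[OF subspace_W Z]) (use Y R_in in auto)
    also have "\<dots> = of_nat (card (carrier G)) * \<phi> v"
      using tr by simp
    finally have "c = \<kappa> * \<phi> v" using d(1) by (simp add: \<kappa>_def field_simps)
    then have "T u = (\<kappa> * \<phi> v) *s u" using c[OF u] by simp
    moreover have "T u = (\<Sum>g\<in>carrier G. \<phi> (R (inv g) u) *s R g v)"
      unfolding T_def Y_def by (rule sum.cong) (simp_all add: endo_scale[OF endo_R])
    ultimately show ?thesis by simp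
  qed
  moreover have "\<kappa> * d = of_nat (card (carrier G))" using d(1) by (simp add: \<kappa>_def)
  ultimately show ?thesis using that d by blast
qed

text \<open>Fourier inversion, an explicit form of Burnside's theorem that the \<open>R g\<close>
  span all operators on \<open>W\<close>. It is Schur orthogonality with \<open>u = T b\<close>,
  summed over a frame; \<open>\<gamma>\<close> is the inverse of \<open>\<kappa>\<close>.\<close>

lemma endo_expansion:
  obtains \<gamma> where "\<And>T v. endo T \<Longrightarrow> (\<And>w. w \<in> W \<Longrightarrow> T w \<in> W) \<Longrightarrow> v \<in> W \<Longrightarrow>
    T v = (\<Sum>g\<in>carrier G. (\<gamma> * trace_on W (\<lambda>x. R (inv g) (T x))) *s R g v)"
proof -
  obtain d \<kappa> where \<kappa>: "d \<noteq> 0" "\<kappa> * d = of_nat (card (carrier G))" "\<And>c. trace_on W (\<lambda>v. c *s v) = c * d"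
    and orth: "\<And>\<phi> u v. functional \<phi> \<Longrightarrow> u \<in> W \<Longrightarrow> v \<in> W \<Longrightarrow>
      (\<Sum>g\<in>carrier G. \<phi> (R (inv g) u) *s R g v) = (\<kappa> * \<phi> v) *s u"
    using schur_orthogonality by blast
  obtain B \<phi> where fr: "frame W B \<phi>" using frame_exists[OF subspace_W] .
  have \<kappa>0: "\<kappa> \<noteq> 0" using \<kappa> card_carrier_ne_0 by auto
  have "T v = (\<Sum>g\<in>carrier G. (inverse \<kappa> * trace_on W (\<lambda>x. R (inv g) (T x))) *s R g v)"
    if T: "endo T" "\<And>w. w \<in> W \<Longrightarrow> T w \<in> W" and v: "v \<in> W" for T v
  proof -
    have tr: "trace_on W (\<lambda>x. R (inv g) (T x)) = (\<Sum>b\<in>B. \<phi> b (R (inv g) (T b)))"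
      if "g \<in> carrier G" for g
      by (rule trace_on_eq[OF fr]) (use that T in \<open>auto intro: endo_comp endo_R R_in\<close>)
    have "(\<Sum>g\<in>carrier G. (inverse \<kappa> * trace_on W (\<lambda>x. R (inv g) (T x))) *s R g v) =
        (\<Sum>g\<in>carrier G. inverse \<kappa> *s (\<Sum>b\<in>B. \<phi> b (R (inv g) (T b)) *s R g v))"
      by (rule sum.cong) (simp_all add: tr scale_sum_left sum_distrib_left scale_sum_right)
    also have "\<dots> = inverse \<kappa> *s (\<Sum>b\<in>B. \<Sum>g\<in>carrier G. \<phi> b (R (inv g) (T b)) *s R g v)"
      unfolding scale_sum_right[symmetric] by (subst sum.swap) simp
    also have "(\<Sum>b\<in>B. \<Sum>g\<in>carrier G. \<phi> b (R (inv g) (T b)) *s R g v) = (\<Sum>b\<in>B. (\<kappa> * \<phi> b v) *s T b)"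
      by (rule sum.cong) (use orth frameD[OF fr] T(2) v in simp_all)
    also have "\<dots> = \<kappa> *s T (\<Sum>b\<in>B. \<phi> b v *s b)"
      by (simp add: endo_sum[OF T(1)] endo_scale[OF T(1)] scale_sum_right)
    finally show ?thesis using \<kappa>0 frameD(5)[OF fr v] by simp
  qed
  then show ?thesis using that by blast
qed

text \<open>With both traces expanded in a frame, Schur orthogonality reduces the terms of each
  \<open>b\<close> to \<open>\<kappa> * \<phi> b b\<close>. Their sum is \<open>\<kappa>\<close>
  times the dimension, which is the group order.\<close>

lemma character_orthogonality:
  "(\<Sum>g\<in>carrier G. trace_on W (R g) * trace_on W (R (inv g))) = of_nat (card (carrier G))"
proof -
  obtain d \<kappa> where \<kappa>: "d \<noteq> 0" "\<kappa> * d = of_nat (card (carrier G))" "\<And>c. trace_on W (\<lambda>v. c *s v) = c * d"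
    and orth: "\<And>\<phi> u v. functional \<phi> \<Longrightarrow> u \<in> W \<Longrightarrow> v \<in> W \<Longrightarrow>
      (\<Sum>g\<in>carrier G. \<phi> (R (inv g) u) *s R g v) = (\<kappa> * \<phi> v) *s u"
    using schur_orthogonality by blast
  obtain B \<phi> where fr: "frame W B \<phi>" using frame_exists[OF subspace_W] .
  have tr: "trace_on W (R g) = (\<Sum>b\<in>B. \<phi> b (R g b))" if "g \<in> carrier G" for g
    by (rule trace_on_eq[OF fr]) (use that in \<open>auto intro: endo_R R_in\<close>)
  have "(\<Sum>g\<in>carrier G. trace_on W (R g) * trace_on W (R (inv g))) =
      (\<Sum>g\<in>carrier G. \<Sum>b\<in>B. \<Sum>c\<in>B. \<phi> b (R g b) * \<phi> c (R (inv g) c))"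
    by (rule sum.cong) (simp_all add: tr sum_product)
  also have "\<dots> = (\<Sum>b\<in>B. \<Sum>g\<in>carrier G. \<Sum>c\<in>B. \<phi> b (R g b) * \<phi> c (R (inv g) c))"
    by (rule sum.swap)
  also have "\<dots> = (\<Sum>b\<in>B. \<Sum>c\<in>B. \<Sum>g\<in>carrier G. \<phi> b (R g b) * \<phi> c (R (inv g) c))"
    by (rule sum.cong[OF refl], rule sum.swap)
  also have "\<dots> = (\<Sum>b\<in>B. \<kappa> * \<phi> b b)"
  proof (rule sum.cong[OF refl])
    fix b assume b: "b \<in> B"
    note fb = frameD(3)[OF fr b]
    have "(\<Sum>c\<in>B. \<Sum>g\<in>carrier G. \<phi> b (R g b) * \<phi> c (R (inv g) c)) =
        (\<Sum>c\<in>B. \<phi> b (\<Sum>g\<in>carrier G. \<phi> c (R (inv g) c) *s R g b))"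
      by (simp add: functional_sum[OF fb] functional_scale[OF fb] mult.commute)
    also have "\<dots> = (\<Sum>c\<in>B. \<phi> b ((\<kappa> * \<phi> c b) *s c))"
      by (rule sum.cong) (use orth frameD[OF fr] b in simp_all)
    also have "\<dots> = \<kappa> * \<phi> b (\<Sum>c\<in>B. \<phi> c b *s c)"
      by (simp add: functional_sum[OF fb] functional_scale[OF fb] sum_distrib_left mult.assoc)
    finally show "(\<Sum>c\<in>B. \<Sum>g\<in>carrier G. \<phi> b (R g b) * \<phi> c (R (inv g) c)) = \<kappa> * \<phi> b b"
      using frameD(5)[OF fr frameD(2)[OF fr b]] by simp
  qed
  also have "\<dots> = \<kappa> * trace_on W (\<lambda>v. 1 *s v)"
    using trace_on_eq[OF fr linear_scale_self, of 1] by (simp add: sum_distrib_left)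
  finally show ?thesis using \<kappa>(2) \<kappa>(3)[of 1] by simp
qed

text \<open>
  With respect to a frame, the trace of \<open>R g \<circ> R g\<close> is \<open>\<Sum>b c. \<phi> b (R g c) * \<phi> c (R g b)\<close>;
  the symmetry hypothesis turns its sum over the group into the sum of \<open>(trace (R g))\<^sup>2\<close>.
\<close>

lemma sum_trace_squares:
  assumes sym: "\<And>\<phi> \<psi> u v. functional \<phi> \<Longrightarrow> functional \<psi> \<Longrightarrow> u \<in> W \<Longrightarrow> v \<in> W \<Longrightarrow>
      (\<Sum>g\<in>carrier G. \<phi> (R g u) * \<psi> (R g v)) = (\<Sum>g\<in>carrier G. \<phi> (R g v) * \<psi> (R g u))"
    and real: "\<And>g. g \<in> carrier G \<Longrightarrow> trace_on W (R (inv g)) = trace_on W (R g)"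
  shows "(\<Sum>g\<in>carrier G. trace_on W (R (g \<otimes> g))) = of_nat (card (carrier G))"
proof -
  obtain B \<phi> where fr: "frame W B \<phi>" using frame_exists[OF subspace_W] .
  have tr: "trace_on W (R g) = (\<Sum>b\<in>B. \<phi> b (R g b))" if "g \<in> carrier G" for g
    by (rule trace_on_eq[OF fr]) (use that in \<open>auto intro: endo_R R_in\<close>)
  have tr2: "trace_on W (R (g \<otimes> g)) = (\<Sum>b\<in>B. \<Sum>c\<in>B. \<phi> b (R g c) * \<phi> c (R g b))"
    if g: "g \<in> carrier G" for g
  proof -
    have "\<phi> b (R (g \<otimes> g) b) = (\<Sum>c\<in>B. \<phi> b (R g c) * \<phi> c (R g b))" if b: "b \<in> B" for b
    proof -
      have "R (g \<otimes> g) b = R g (\<Sum>c\<in>B. \<phi> c (R g b) *s c)"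
        using R_mult[OF g g] frameD(2)[OF fr b] frameD(5)[OF fr] R_in[OF g] by simp
      then show ?thesis
        using frameD(3)[OF fr b] endo_R[OF g]
        by (simp add: functional_sum functional_scale endo_sum endo_scale mult.commute)
    qed
    then show ?thesis using tr[of "g \<otimes> g"] g by simp
  qed
  have "(\<Sum>g\<in>carrier G. trace_on W (R (g \<otimes> g))) =
      (\<Sum>g\<in>carrier G. \<Sum>b\<in>B. \<Sum>c\<in>B. \<phi> b (R g c) * \<phi> c (R g b))"
    using tr2 by simp
  also have "\<dots> = (\<Sum>b\<in>B. \<Sum>g\<in>carrier G. \<Sum>c\<in>B. \<phi> b (R g c) * \<phi> c (R g b))"
    by (rule sum.swap)
  also have "\<dots> = (\<Sum>b\<in>B. \<Sum>c\<in>B. \<Sum>g\<in>carrier G. \<phi> b (R g c) * \<phi> c (R g b))"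
    by (rule sum.cong[OF refl], rule sum.swap)
  also have "\<dots> = (\<Sum>b\<in>B. \<Sum>c\<in>B. \<Sum>g\<in>carrier G. \<phi> b (R g b) * \<phi> c (R g c))"
    using sym frameD(2,3)[OF fr] by simp
  also have "\<dots> = (\<Sum>b\<in>B. \<Sum>g\<in>carrier G. \<Sum>c\<in>B. \<phi> b (R g b) * \<phi> c (R g c))"
    by (rule sum.cong[OF refl], rule sum.swap)
  also have "\<dots> = (\<Sum>g\<in>carrier G. \<Sum>b\<in>B. \<Sum>c\<in>B. \<phi> b (R g b) * \<phi> c (R g c))"
    by (rule sum.swap)
  also have "\<dots> = (\<Sum>g\<in>carrier G. trace_on W (R g) * trace_on W (R (inv g)))"
    by (rule sum.cong) (simp_all add: tr[symmetric] real sum_product[symmetric])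
  finally show ?thesis using character_orthogonality by simp
qed

end

subsection \<open>Skew-symmetric invariant forms\<close>

context group_rep
begin

text \<open>Bilinearity is required on the whole space, the other two conditions on
  \<open>W\<close>; thus one and the same \<open>\<beta>\<close> can be passed on to
  subrepresentations.\<close>

definition skew_invariant :: "('v \<Rightarrow> 'v \<Rightarrow> 'k) \<Rightarrow> bool"
  where "skew_invariant \<beta> \<longleftrightarrow> (\<forall>v. functional (\<lambda>u. \<beta> u v) \<and> functional (\<beta> v)) \<and>
    (\<forall>u\<in>W. \<forall>v\<in>W. \<beta> u v = - \<beta> v u) \<and>
    (\<forall>g\<in>carrier G. \<forall>u\<in>W. \<forall>v\<in>W. \<beta> (R g u) (R g v) = \<beta> u v)"

lemma trace_on_conjugate:
  assumes "h \<in> carrier G" "endo T" "\<And>w. w \<in> W \<Longrightarrow> T w \<in> W"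
  shows "trace_on W (\<lambda>x. R h (T (R (inv h) x))) = trace_on W T"
proof -
  have "trace_on W (\<lambda>x. R h (T (R (inv h) x))) = trace_on W (\<lambda>x. T (R (inv h) (R h x)))"
    by (rule trace_on_comp_commute[OF subspace_W, of "R h" "\<lambda>x. T (R (inv h) x)"])
      (use assms in \<open>simp_all add: endo_R R_in endo_comp[OF assms(2) endo_R]\<close>)
  also have "\<dots> = trace_on W T"
    by (rule trace_on_cong) (use assms in \<open>simp add: R_inv_R\<close>)
  finally show ?thesis .
qed

text \<open>The difference of the two sides is a skew-symmetric invariant form in \<open>u\<close>
  and \<open>v\<close>: antisymmetrize the product of \<open>\<phi>\<close> and
  \<open>\<psi>\<close> and sum over the group.\<close>

lemma skew_symmetrization:
  assumes "\<And>\<beta> u v. skew_invariant \<beta> \<Longrightarrow> u \<in> W \<Longrightarrow> v \<in> W \<Longrightarrow> \<beta> u v = 0"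
    and \<phi>: "functional \<phi>" and \<psi>: "functional \<psi>" and u: "u \<in> W" "v \<in> W"
  shows "(\<Sum>g\<in>carrier G. \<phi> (R g u) * \<psi> (R g v)) = (\<Sum>g\<in>carrier G. \<phi> (R g v) * \<psi> (R g u))"
proof -
  define \<beta> where "\<beta> u v = (\<Sum>g\<in>carrier G. \<phi> (R g u) * \<psi> (R g v) - \<phi> (R g v) * \<psi> (R g u))" for u v
  have "skew_invariant \<beta>"
    unfolding skew_invariant_def
  proof (intro conjI ballI allI)
    note lin = endo_add[OF endo_R] endo_scale[OF endo_R] functional_add[OF \<phi>] functional_add[OF \<psi>]
      functional_scale[OF \<phi>] functional_scale[OF \<psi>]
    show "functional (\<lambda>u. \<beta> u v)" for v
      unfolding \<beta>_def by (intro functional_sum_fun functionalI) (simp_all add: lin algebra_simps)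
    show "functional (\<beta> u)" for u
      unfolding \<beta>_def by (intro functional_sum_fun functionalI) (simp_all add: lin algebra_simps)
    show "\<beta> u v = - \<beta> v u" for u v
      unfolding \<beta>_def sum_negf[symmetric] by simp
    show "\<beta> (R h u) (R h v) = \<beta> u v" if "h \<in> carrier G" "u \<in> W" "v \<in> W" for h u v
      unfolding \<beta>_def sum_mult_right[OF that(1), symmetric,
        of "\<lambda>g. \<phi> (R g u) * \<psi> (R g v) - \<phi> (R g v) * \<psi> (R g u)"]
      by (rule sum.cong) (use that in \<open>simp_all add: R_mult\<close>)
  qed
  then have "\<beta> u v = 0" using assms(1) u by blast
  then show ?thesis by (simp add: \<beta>_def sum_subtractf)
qed

end

context irreducible_rep
begin

text \<open>
  The equivariant projection \<open>\<pi>\<close> onto \<open>U\<close> is a combination of the \<open>R g\<close> whose coefficients are constant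
  on \<open>K\<close>-conjugacy classes, hence invariant under \<open>g \<mapsto> inv g\<close>; therefore \<open>\<pi>\<close> is self-adjoint.
\<close>

lemma skew_invariant_eq_0:
  assumes K: "subgroup K G"
    and conj: "\<And>g. g \<in> carrier G \<Longrightarrow> \<exists>k\<in>K. k \<otimes> g \<otimes> inv k = inv g"
    and sub: "\<And>U u v. irreducible_rep (*s) Basis (G\<lparr>carrier := K\<rparr>) R U \<Longrightarrow>
      group_rep.skew_invariant (*s) (G\<lparr>carrier := K\<rparr>) R U \<beta> \<Longrightarrow> u \<in> U \<Longrightarrow> v \<in> U \<Longrightarrow> \<beta> u v = 0"
    and \<beta>: "skew_invariant \<beta>" and uv: "u \<in> W" "v \<in> W"
  shows "\<beta> u v = 0"
proof -
  have fun1: "functional (\<lambda>u. \<beta> u v)" and fun2: "functional (\<beta> u)" for u v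
    using \<beta> unfolding skew_invariant_def by blast+
  have skew: "\<beta> u v = - \<beta> v u" if "u \<in> W" "v \<in> W" for u v
    using \<beta> that unfolding skew_invariant_def by blast
  have inva: "\<beta> (R g u) (R g v) = \<beta> u v" if "g \<in> carrier G" "u \<in> W" "v \<in> W" for g u v
    using \<beta> that unfolding skew_invariant_def by blast
  have adj: "\<beta> (R g u) v = \<beta> u (R (inv g) v)" if "g \<in> carrier G" "u \<in> W" "v \<in> W" for g u v
    using inva[OF that(1,2), of "R (inv g) v"] that by (simp add: R_in R_R_inv)
  have KG: "k \<in> carrier G" if "k \<in> K" for k using that subgroup.mem_carrier[OF K] by blast
  interpret K: group_rep "(*s)" Basis "G\<lparr>carrier := K\<rparr>" R W
    using restrict_subgroup[OF K] .
  obtain U where U: "K.invariant U" "irreducible_rep (*s) Basis (G\<lparr>carrier := K\<rparr>) R U"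
    using K.irreducible_subrep_exists[OF nontrivial] .
  interpret U: irreducible_rep "(*s)" Basis "G\<lparr>carrier := K\<rparr>" R U by fact
  have UW: "U \<subseteq> W" using U(1) by (simp add: K.invariant_def)
  have "U.skew_invariant \<beta>"
    unfolding U.skew_invariant_def
  proof (intro conjI ballI allI)
    show "\<beta> u v = - \<beta> v u" if "u \<in> U" "v \<in> U" for u v
      using that UW by (intro skew) auto
    show "\<beta> (R k u) (R k v) = \<beta> u v"
      if "k \<in> carrier (G\<lparr>carrier := K\<rparr>)" "u \<in> U" "v \<in> U" for k u v
      using that UW KG by (intro inva) auto
  qed (rule fun1 fun2)+
  then have \<beta>U: "\<beta> u v = 0" if "u \<in> U" "v \<in> U" for u v
    using sub[OF U(2)] that by blast
  obtain \<pi> where \<pi>: "endo \<pi>" "\<And>w. w \<in> W \<Longrightarrow> \<pi> w \<in> U" "\<And>u. u \<in> U \<Longrightarrow> \<pi> u = u"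
    "\<And>k w. k \<in> K \<Longrightarrow> w \<in> W \<Longrightarrow> \<pi> (R k w) = R k (\<pi> w)"
    using K.invariant_complement[OF U(1)] by auto
  have \<pi>W: "\<pi> w \<in> W" if "w \<in> W" for w using \<pi>(2)[OF that] UW by blast
  obtain \<gamma> where expansion: "\<And>T v. endo T \<Longrightarrow> (\<And>w. w \<in> W \<Longrightarrow> T w \<in> W) \<Longrightarrow> v \<in> W \<Longrightarrow>
      T v = (\<Sum>g\<in>carrier G. (\<gamma> * trace_on W (\<lambda>x. R (inv g) (T x))) *s R g v)"
    using endo_expansion by blast
  define c where "c g = \<gamma> * trace_on W (\<lambda>x. R (inv g) (\<pi> x))" for g
  have \<pi>_sum: "\<pi> w = (\<Sum>g\<in>carrier G. c g *s R g w)" if "w \<in> W" for w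
    unfolding c_def by (rule expansion[OF \<pi>(1) \<pi>W that])
  have c_inv: "c (inv g) = c g" if g: "g \<in> carrier G" for g
  proof -
    obtain k where k: "k \<in> K" "k \<otimes> g \<otimes> inv k = inv g" using conj[OF g] by blast
    have kG: "k \<in> carrier G" using k(1) KG by blast
    have kinv: "inv k \<in> K" using K k(1) by (rule subgroup.m_inv_closed)
    \<comment> \<open>Inverting the relation for \<open>g\<close> shows that the same
      \<open>k\<close> conjugates \<open>inv g\<close> to \<open>g\<close>.\<close>
    have "inv (inv g) = k \<otimes> inv g \<otimes> inv k"
      using k(2) g kG by (metis inv_closed inv_inv inv_mult_group m_assoc m_closed)
    moreover have "R (k \<otimes> inv g \<otimes> inv k) (\<pi> w) = R k (R (inv g) (\<pi> (R (inv k) w)))" if "w \<in> W" for w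
      using that g kG \<pi>(4)[OF kinv that] \<pi>W[OF that] by (simp add: R_mult R_in)
    ultimately have "R (inv (inv g)) (\<pi> w) = R k (R (inv g) (\<pi> (R (inv k) w)))" if "w \<in> W" for w
      using that by metis
    then have "trace_on W (\<lambda>x. R (inv (inv g)) (\<pi> x)) =
        trace_on W (\<lambda>x. R k (R (inv g) (\<pi> (R (inv k) x))))"
      by (rule trace_on_cong)
    also have "\<dots> = trace_on W (\<lambda>x. R (inv g) (\<pi> x))"
      by (rule trace_on_conjugate[OF kG, of "\<lambda>x. R (inv g) (\<pi> x)"])
        (use g \<pi>(1) \<pi>W in \<open>auto intro: endo_comp endo_R R_in\<close>)
    finally show ?thesis by (simp add: c_def)
  qed
  have self_adjoint: "\<beta> (\<pi> u) v = \<beta> u (\<pi> v)" if u: "u \<in> W" and v: "v \<in> W" for u v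
  proof -
    have "\<beta> (\<pi> u) v = (\<Sum>g\<in>carrier G. c g * \<beta> (R g u) v)"
      unfolding \<pi>_sum[OF u] by (simp add: functional_sum[OF fun1] functional_scale[OF fun1])
    also have "\<dots> = (\<Sum>g\<in>carrier G. c (inv g) * \<beta> u (R (inv g) v))"
      by (rule sum.cong) (use adj u v c_inv in simp_all)
    also have "\<dots> = (\<Sum>g\<in>carrier G. c g * \<beta> u (R g v))"
      by (rule sum_inverse)
    also have "\<dots> = \<beta> u (\<pi> v)"
      unfolding \<pi>_sum[OF v] by (simp add: functional_sum[OF fun2] functional_scale[OF fun2])
    finally show ?thesis .
  qed
  let ?rad = "{u \<in> W. \<forall>v\<in>W. \<beta> u v = 0}"
  \<comment> \<open>For \<open>u\<close> in \<open>U\<close> and \<open>v\<close> in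
    \<open>W\<close>, \<open>\<beta> u v = \<beta> (\<pi> u) v = \<beta> u (\<pi> v)\<close>, and
    now both arguments lie in \<open>U\<close>.\<close>
  have "U \<subseteq> ?rad"
    using self_adjoint \<pi>(2,3) \<beta>U UW by (auto, metis subsetD)
  moreover have "\<exists>w\<in>U. w \<noteq> 0"
    using U.nontrivial U.subspace_W subspace_0 by blast
  moreover have "invariant ?rad"
    unfolding invariant_def using subspace_W fun1 R_in adj
    by (auto simp: subspace_def functional_zero[OF fun1] functional_add[OF fun1] functional_scale[OF fun1])
  ultimately have "?rad = W" using irreducible by blast
  then show ?thesis using uv by blast
qed

end

section \<open>Finite symmetric groups\<close>

lemma permutes_funpow_period:
  assumes "p permutes A" "finite A"
  obtains N where "N > 0" "p ^^ N = id"
proof -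
  have "permutation p" using assms permutation_permutes by blast
  then show ?thesis using permutation_is_nilpotent that by metis
qed

text \<open>
  Choose a base point \<open>r x\<close> in every orbit of \<open>p\<close>, the point \<open>a\<close> being chosen in its own orbit, and
  let \<open>q\<close> send \<open>p\<^sup>k (r x)\<close> to \<open>p\<^sup>-\<^sup>k (r x)\<close>.
\<close>

lemma permutes_conj_inv:
  assumes p: "p permutes A" and fin: "finite A"
  obtains q where "q permutes A" "q a = a" "q \<circ> p = inv' p \<circ> q"
proof -
  obtain N where N: "N > 0" "p ^^ N = id" using permutes_funpow_period[OF assms] .
  have N1: "(p ^^ (N * k)) x = x" for k x
    by (induction k) (simp_all add: N funpow_add funpow_mult[symmetric] del: funpow.simps)
  \<comment> \<open>\<open>p ^^ m k\<close> is the inverse of \<open>p ^^ k\<close>, written with a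
    natural exponent by means of the period \<open>N\<close>.\<close>
  define m where "m k = (N - 1) * k" for k
  have mk: "k + m k = N * k" for k using N(1) by (cases N) (simp_all add: m_def)
  have cancel: "(p ^^ k) ((p ^^ m k) x) = x" "(p ^^ m k) ((p ^^ k) x) = x" for k x
  proof -
    show "(p ^^ k) ((p ^^ m k) x) = x" using N1[of k x] mk by (metis comp_apply funpow_add)
    show "(p ^^ m k) ((p ^^ k) x) = x" using N1[of k x] mk by (metis add.commute comp_apply funpow_add)
  qed
  \<comment> \<open>Negative powers depend only on the point reached by the positive ones, so
    \<open>q\<close> will not depend on which exponent \<open>e x\<close> is chosen.\<close>
  have well: "(p ^^ m i) x = (p ^^ m j) x" if "(p ^^ i) x = (p ^^ j) x" for i j x
  proof -
    have "(p ^^ (m i + m j)) ((p ^^ i) x) = (p ^^ (m i + m j)) ((p ^^ j) x)" using that by simp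
    moreover have "(p ^^ (m i + m j)) ((p ^^ i) x) = (p ^^ m j) x"
      by (metis add.commute comp_apply funpow_add cancel(2))
    moreover have "(p ^^ (m i + m j)) ((p ^^ j) x) = (p ^^ m i) x"
      by (metis comp_apply funpow_add cancel(2))
    ultimately show ?thesis by simp
  qed
  define orb where "orb x = {y. \<exists>k. y = (p ^^ k) x}" for x
  have orb_self: "x \<in> orb x" for x unfolding orb_def by (auto intro: exI[of _ 0])
  have orb_eq: "orb ((p ^^ k) x) = orb x" for k x
  proof -
    have "(p ^^ l) x = (p ^^ (l + m k)) ((p ^^ k) x)" for l
      by (simp add: funpow_add cancel)
    moreover have "(p ^^ l) ((p ^^ k) x) = (p ^^ (l + k)) x" for l by (simp add: funpow_add)
    ultimately show ?thesis unfolding orb_def by blast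
  qed
  \<comment> \<open>The base point is a function of the set \<open>orb x\<close> alone, so
    \<open>orb_eq\<close> makes it the same for all points of an orbit.\<close>
  define r where "r x = (if a \<in> orb x then a else SOME y. y \<in> orb x)" for x
  have "r x \<in> orb x" for x using orb_self someI_ex[of "\<lambda>y. y \<in> orb x"] by (auto simp: r_def)
  then have "\<exists>k. r x = (p ^^ k) x" for x by (simp add: orb_def)
  then have "\<exists>k. x = (p ^^ k) (r x)" for x using cancel(2) by metis
  then obtain e where e: "(p ^^ e x) (r x) = x" for x by metis
  have r_eq: "r ((p ^^ k) x) = r x" for k x by (simp add: r_def orb_eq)
  define q where "q x = (p ^^ m (e x)) (r x)" for x
  have q_eq: "q x = (p ^^ m k) (r x)" if "x = (p ^^ k) (r x)" for x k
    unfolding q_def by (rule well) (use that e in simp)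
  have rq: "r (q x) = r x" for x
    using r_eq[of "m (e x)" "r x"] r_eq[of "e x" "r x"] e[of x] by (simp add: q_def)
  have qq: "q (q x) = x" for x
  proof -
    have "q (q x) = (p ^^ m (m (e x))) (r x)"
      using q_eq[of "q x" "m (e x)"] rq by (simp add: q_def)
    also have "\<dots> = (p ^^ m (m (e x))) ((p ^^ m (e x)) ((p ^^ e x) (r x)))"
      by (simp add: cancel)
    also have "\<dots> = x" by (simp add: cancel e)
    finally show ?thesis .
  qed
  have qa: "q a = a"
  proof -
    have "r a = a" using orb_self by (simp add: r_def)
    then show ?thesis using q_eq[of a 0] by (simp add: m_def)
  qed
  have inj_p: "inj p" using p permutes_inj by blast
  have pq: "q (p x) = inv' p (q x)" for x
  proof -
    have rp: "r (p x) = r x" using r_eq[of 1 x] by simp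
    have "p x = (p ^^ Suc (e x)) (r (p x))" using e[of x] rp by simp
    then have qpx: "q (p x) = (p ^^ m (Suc (e x))) (r x)" using q_eq[of "p x" "Suc (e x)"] rp by simp
    have "p (q (p x)) = q x"
    proof -
      \<comment> \<open>Since \<open>m (Suc k) = (N - 1) + m k\<close>, one further application of
        \<open>p\<close> completes a full period.\<close>
      have "p ((p ^^ m (Suc (e x))) (r x)) = (p ^^ N) ((p ^^ m (e x)) (r x))"
        using N(1) by (cases N) (simp_all add: m_def funpow_add)
      then show ?thesis unfolding qpx by (simp add: N q_def)
    qed
    then show ?thesis using inj_p by (metis inv_f_f)
  qed
  have "q x = x" if "x \<notin> A" for x
  proof -
    have px: "(p ^^ k) x = x" for k
      by (induction k) (use p that permutes_not_in in fastforce)+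
    then have "r x = x" using r_eq[of "e x" x] orb_self by (auto simp: r_def orb_def)
    then show ?thesis by (simp add: q_def px)
  qed
  \<comment> \<open>As an involution, \<open>q\<close> has the unique preimages that
    \<open>permutes_def\<close> asks for.\<close>
  then have "q permutes A" unfolding permutes_def using qq by metis
  moreover have "q \<circ> p = inv' p \<circ> q" using pq by (simp add: fun_eq_iff)
  ultimately show ?thesis using that qa by blast
qed

section \<open>Indicators of symmetric groups on arbitrary finite sets\<close>

text \<open>Arbitrary sets replace \<open>{1..n}\<close> because the induction removes points one at
  a time, and because the stabilizers in the application permute sets with gaps.\<close>

definition perm_group :: "'a set \<Rightarrow> ('a \<Rightarrow> 'a) monoid"
  where "perm_group A = \<lparr>carrier = {p. p permutes A}, monoid.mult = (\<circ>), one = id\<rparr>"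

lemma perm_group_simps [simp]:
  "p \<in> carrier (perm_group A) \<longleftrightarrow> p permutes A"
  "x \<otimes>\<^bsub>perm_group A\<^esub> y = x \<circ> y" "\<one>\<^bsub>perm_group A\<^esub> = id"
  "perm_group A\<lparr>carrier := {p. p permutes B}\<rparr> = perm_group B"
  by (simp_all add: perm_group_def)

lemma carrier_perm_group: "carrier (perm_group A) = {p. p permutes A}"
  by (simp add: perm_group_def)

lemma group_perm_group: "group (perm_group A)"
proof (rule groupI)
  fix p assume "p \<in> carrier (perm_group A)"
  then show "\<exists>q\<in>carrier (perm_group A). q \<otimes>\<^bsub>perm_group A\<^esub> p = \<one>\<^bsub>perm_group A\<^esub>"
    by (intro bexI[of _ "inv' p"]) (simp_all add: permutes_inv permutes_inv_o)
qed (auto intro: permutes_compose permutes_id simp: o_assoc)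

lemma inv_perm_group: "p permutes A \<Longrightarrow> inv\<^bsub>perm_group A\<^esub> p = inv' p"
  by (rule group.inv_equality[OF group_perm_group]) (simp_all add: permutes_inv permutes_inv_o)

lemma subgroup_perm_group:
  assumes "B \<subseteq> A"
  shows "subgroup {p. p permutes B} (perm_group A)"
proof (rule group.subgroupI[OF group_perm_group])
  fix p assume p: "p \<in> {p. p permutes B}"
  then have "p permutes A" using assms permutes_subset by blast
  then show "inv\<^bsub>perm_group A\<^esub> p \<in> {p. p permutes B}"
    using p by (simp add: inv_perm_group permutes_inv)
qed (use assms in \<open>auto intro: permutes_compose permutes_id permutes_subset\<close>)

text \<open>Induction on \<open>A\<close>, passing to the stabilizer of one point by
  \<open>skew_invariant_eq_0\<close>. The subspace is generalized, since the hypothesis is applied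
  to a subrepresentation, while \<open>R\<close> and \<open>\<beta>\<close> stay fixed.\<close>

lemma (in fd_space) skew_invariant_perm_group_eq_0:
  assumes "finite A" "irreducible_rep (*s) Basis (perm_group A) R W"
    "group_rep.skew_invariant (*s) (perm_group A) R W \<beta>" "u \<in> W" "v \<in> W"
  shows "\<beta> u v = 0"
  using assms
proof (induction A arbitrary: W u v rule: finite_induct)
  case empty
  interpret irreducible_rep "(*s)" Basis "perm_group {}" R W by fact
  have R_id: "R g w = w" if "g permutes {}" "w \<in> W" for g w
    using that R_one by simp
  show ?case
  proof (cases "u = 0")
    case True
    then show ?thesis using empty(2) functional_zero[of "\<lambda>u. \<beta> u v"]
      by (simp add: skew_invariant_def)
  next
    case False
    \<comment> \<open>Under the trivial group every subspace of \<open>W\<close> is invariant, so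
      \<open>W\<close> is a line, and a skew form on a line is 0 in characteristic 0.\<close>
    have "span {u} \<subseteq> W" using empty(3) subspace_W by (intro span_minimal) auto
    then have "invariant (span {u})" using R_id by (auto simp: invariant_def)
    moreover have "u \<in> span {u}" by (rule span_base) simp
    ultimately have "span {u} = W" using irreducible False by blast
    then obtain c where v: "v = c *s u" using empty(4) by (auto simp: span_singleton)
    have "\<beta> u u = - \<beta> u u" "functional (\<beta> u)"
      using empty(2,3) unfolding skew_invariant_def by blast+
    then have "\<beta> u u = 0" by simp
    then show ?thesis using v \<open>functional (\<beta> u)\<close> by (simp add: functional_scale)
  qed
next
  case (insert a A)
  interpret irreducible_rep "(*s)" Basis "perm_group (insert a A)" R W by fact
  show ?case
  proof (rule skew_invariant_eq_0[of "{p. p permutes A}"])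
    show "subgroup {p. p permutes A} (perm_group (insert a A))"
      by (rule subgroup_perm_group) auto
    show "\<beta> u v = 0" if "irreducible_rep (*s) Basis (perm_group (insert a A)\<lparr>carrier := {p. p permutes A}\<rparr>) R U"
      "group_rep.skew_invariant (*s) (perm_group (insert a A)\<lparr>carrier := {p. p permutes A}\<rparr>) R U \<beta>"
      "u \<in> U" "v \<in> U" for U u v
      using insert.IH that by simp
    fix p assume "p \<in> carrier (perm_group (insert a A))"
    then have p: "p permutes insert a A" by simp
    \<comment> \<open>That the conjugating permutation fixes \<open>a\<close> puts it into the
      subgroup of permutations of \<open>A\<close>.\<close>
    obtain q where q: "q permutes insert a A" "q a = a" "q \<circ> p = inv' p \<circ> q"
      using permutes_conj_inv[OF p] insert.hyps(1) by (metis finite.insertI)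
    have "q permutes A" using q(1,2) permutes_superset by blast
    moreover have "q \<circ> p \<circ> inv' q = inv' p"
      unfolding q(3) using permutes_inv_o(1)[OF q(1)] by (simp add: comp_assoc)
    ultimately show "\<exists>k\<in>{p. p permutes A}. k \<otimes>\<^bsub>perm_group (insert a A)\<^esub> p \<otimes>\<^bsub>perm_group (insert a A)\<^esub>
        inv\<^bsub>perm_group (insert a A)\<^esub> k = inv\<^bsub>perm_group (insert a A)\<^esub> p"
      using p q(1) by (intro bexI[of _ q]) (simp_all add: inv_perm_group)
  qed (use insert.prems in auto)
qed

text \<open>The classical indicator is 1, multiplied here by the group order. In
  \<open>sum_trace_squares\<close> the symmetry comes from the absence of skew forms, the reality of
  the character from conjugacy of \<open>p\<close> with its inverse.\<close>

theorem (in fd_space) sum_trace_squares_perm_group: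
  assumes fin: "finite A" and irr: "irreducible_rep (*s) Basis (perm_group A) R W"
  shows "(\<Sum>p | p permutes A. trace_on W (R (p \<circ> p))) = of_nat (fact (card A))"
proof -
  interpret irreducible_rep "(*s)" Basis "perm_group A" R W by fact
  have "(\<Sum>p\<in>carrier (perm_group A). trace_on W (R (p \<otimes>\<^bsub>perm_group A\<^esub> p))) =
      of_nat (card (carrier (perm_group A)))"
  proof (rule sum_trace_squares)
    fix p assume "p \<in> carrier (perm_group A)"
    then have p: "p permutes A" by simp
    obtain q where q: "q permutes A" "q \<circ> p = inv' p \<circ> q"
      using permutes_conj_inv[OF p fin] by metis
    have ip: "inv' p permutes A" using p by (rule permutes_inv)
    have iq: "inv' q permutes A" using q(1) by (rule permutes_inv)
    have "inv' p = q \<circ> (p \<circ> inv' q)"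
      unfolding comp_assoc[symmetric] q(2) using permutes_inv_o(1)[OF q(1)] by (simp add: comp_assoc)
    moreover have "R (q \<circ> (p \<circ> inv' q)) w = R q (R p (R (inv' q) w))" if "w \<in> W" for w
      using R_mult[of q "p \<circ> inv' q" w] R_mult[of p "inv' q" w] that p q(1) iq
      by (simp add: permutes_compose)
    ultimately have "trace_on W (R (inv' p)) = trace_on W (\<lambda>x. R q (R p (R (inv' q) x)))"
      by (intro trace_on_cong) simp
    also have "\<dots> = trace_on W (R p)"
      using trace_on_conjugate[of q "R p"] q(1) p endo_R R_in by (simp add: inv_perm_group)
    finally show "trace_on W (R (inv\<^bsub>perm_group A\<^esub> p)) = trace_on W (R p)"
      using p by (simp add: inv_perm_group)
  next
    fix \<phi> \<psi> u v assume "functional \<phi>" "functional \<psi>" "u \<in> W" "v \<in> W"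
    moreover have "\<beta> u v = 0" if "skew_invariant \<beta>" "u \<in> W" "v \<in> W" for \<beta> u v
      by (rule skew_invariant_perm_group_eq_0[OF fin irr that])
    ultimately show "(\<Sum>g\<in>carrier (perm_group A). \<phi> (R g u) * \<psi> (R g v)) =
        (\<Sum>g\<in>carrier (perm_group A). \<phi> (R g v) * \<psi> (R g u))"
      by (intro skew_symmetrization)
  qed
  then show ?thesis
    using card_permutations[OF refl fin] by (simp add: carrier_perm_group)
qed

section \<open>Modules over bismash products\<close>

text \<open>\<open>basis_vec\<close> is a delta function and collapses the double sum. The lemma
  serves the comultiplied integral, where \<open>c\<close> is the inverse of \<open>card F\<close>,
  and, with a single summand, products of basis elements.\<close>

lemma hmult_tensor_basis:
  fixes H :: "('k::field, 'b) hopf_data"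
  assumes "finite (hbasis H)" "\<And>i. i \<in> I \<Longrightarrow> p i \<in> hbasis H \<and> q i \<in> hbasis H"
  shows "hmult_tensor H (\<lambda>t. \<Sum>i\<in>I. c * basis_vec (p i, q i) t) =
    (\<lambda>d. \<Sum>i\<in>I. c * mult_basis H (p i) (q i) d)"
proof
  fix d
  let ?B = "hbasis H"
  have "hmult_tensor H (\<lambda>t. \<Sum>i\<in>I. c * basis_vec (p i, q i) t) d =
      (\<Sum>z\<in>?B \<times> ?B. \<Sum>i\<in>I. c * basis_vec (p i, q i) z * mult_basis H (fst z) (snd z) d)"
    unfolding hmult_tensor_def
    by (subst sum.cartesian_product, rule sum.cong) (auto simp: sum_distrib_right)
  also have "\<dots> = (\<Sum>i\<in>I. \<Sum>z\<in>?B \<times> ?B. c * basis_vec (p i, q i) z * mult_basis H (fst z) (snd z) d)"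
    by (rule sum.swap)
  also have "\<dots> = (\<Sum>i\<in>I. c * mult_basis H (p i) (q i) d)"
  proof (rule sum.cong[OF refl])
    fix i assume i: "i \<in> I"
    have "(\<Sum>z\<in>?B \<times> ?B. c * basis_vec (p i, q i) z * mult_basis H (fst z) (snd z) d) =
        (\<Sum>z\<in>?B \<times> ?B. if z = (p i, q i) then c * mult_basis H (p i) (q i) d else 0)"
      by (rule sum.cong) (auto simp: basis_vec_def)
    then show "(\<Sum>z\<in>?B \<times> ?B. c * basis_vec (p i, q i) z * mult_basis H (fst z) (snd z) d) =
        c * mult_basis H (p i) (q i) d"
      using assms i by simp
  qed
  finally show "hmult_tensor H (\<lambda>t. \<Sum>i\<in>I. c * basis_vec (p i, q i) t) d =
      (\<Sum>i\<in>I. c * mult_basis H (p i) (q i) d)" .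
qed

section \<open>The matched pair of a factorized group\<close>

locale factorized_group = group L for L (structure) +
  fixes F G :: "'a set"
  assumes F: "subgroup F L" and G: "subgroup G L"
    and finite_F: "finite F" and finite_G: "finite G"
    and factorization: "g \<in> carrier L \<Longrightarrow> \<exists>a\<in>F. \<exists>x\<in>G. g = a \<otimes> x"
    and F_Int_G: "F \<inter> G = {\<one>}"
begin

lemma F_carrier: "a \<in> F \<Longrightarrow> a \<in> carrier L" and G_carrier: "x \<in> G \<Longrightarrow> x \<in> carrier L"
  using F G by (auto dest: subgroup.mem_carrier)

lemmas F_closed = subgroup.m_closed[OF F] subgroup.m_inv_closed[OF F] subgroup.one_closed[OF F]
  and G_closed = subgroup.m_closed[OF G] subgroup.m_inv_closed[OF G] subgroup.one_closed[OF G]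

lemma card_F_gt_0: "card F > 0"
  using finite_F F_closed(3) by (auto simp: card_gt_0_iff)

lemma F_mult_cancel_left: "a \<in> F \<Longrightarrow> g \<in> carrier L \<Longrightarrow> a \<otimes> g \<in> F \<longleftrightarrow> g \<in> F"
  using F_closed F_carrier by (metis inv_solve_left)

lemma F_mult_cancel_right: "a \<in> F \<Longrightarrow> g \<in> carrier L \<Longrightarrow> g \<otimes> a \<in> F \<longleftrightarrow> g \<in> F"
  using F_closed F_carrier by (metis inv_solve_right)

text \<open>The element \<open>inv b \<otimes> a = y \<otimes> inv x\<close> lies in both subgroups,
  hence is the identity.\<close>

lemma factorization_unique:
  assumes "a \<in> F" "b \<in> F" "x \<in> G" "y \<in> G" "a \<otimes> x = b \<otimes> y"
  shows "a = b" "x = y"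
proof -
  have c: "a \<in> carrier L" "b \<in> carrier L" "x \<in> carrier L" "y \<in> carrier L"
    using assms F_carrier G_carrier by auto
  have "inv b \<otimes> a = y \<otimes> inv x"
    using assms(5) c by (metis inv_closed inv_solve_left inv_solve_right m_assoc m_closed)
  moreover have "inv b \<otimes> a \<in> F" "y \<otimes> inv x \<in> G" using assms F_closed G_closed by auto
  ultimately have "inv b \<otimes> a = \<one>" "y \<otimes> inv x = \<one>" using F_Int_G by auto
  then show "a = b" "x = y" using c
    by (metis inv_closed inv_equality inv_inv, metis inv_closed inv_equality inv_inv)
qed

lemma matched_pair:
  assumes "x \<in> G" "a \<in> F"
  shows lact_in: "lact L F G x a \<in> F" and ract_in: "ract L F G x a \<in> G"
    and lact_ract: "x \<otimes> a = lact L F G x a \<otimes> ract L F G x a"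
proof -
  obtain b y where ba: "b \<in> F" "y \<in> G" "x \<otimes> a = b \<otimes> y"
    using factorization[of "x \<otimes> a"] assms F_carrier G_carrier by auto
  have "lact L F G x a = b"
    unfolding lact_def by (rule the_equality) (use ba factorization_unique in auto)
  moreover have "ract L F G x a = y"
    unfolding ract_def by (rule the_equality) (use ba factorization_unique in auto)
  ultimately show "lact L F G x a \<in> F" "ract L F G x a \<in> G"
    "x \<otimes> a = lact L F G x a \<otimes> ract L F G x a"
    using ba by auto
qed

lemma lact_eq:
  assumes "x \<in> G" "a \<in> F"
  shows "lact L F G x a = x \<otimes> a \<otimes> inv (ract L F G x a)"
  using matched_pair[OF assms] assms F_carrier G_carrier by (simp add: m_assoc)

text \<open>Turns the description of \<open>x \<lhd> a\<close> by \<open>THE\<close> into a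
  membership test; most later computations with the right action go through it.\<close>

lemma ract_eq_iff:
  assumes "x \<in> G" "a \<in> F" "z \<in> G"
  shows "ract L F G x a = z \<longleftrightarrow> x \<otimes> a \<otimes> inv z \<in> F"
proof
  assume "ract L F G x a = z"
  then show "x \<otimes> a \<otimes> inv z \<in> F" using lact_eq[OF assms(1,2)] lact_in[OF assms(1,2)] by simp
next
  assume "x \<otimes> a \<otimes> inv z \<in> F"
  moreover have "(x \<otimes> a \<otimes> inv z) \<otimes> z = lact L F G x a \<otimes> ract L F G x a"
    using matched_pair[OF assms(1,2)] assms F_carrier G_carrier by (simp add: m_assoc)
  ultimately show "ract L F G x a = z"
    using factorization_unique(2) matched_pair[OF assms(1,2)] assms(3) by metis
qed

lemma ract_one: "x \<in> G \<Longrightarrow> ract L F G x \<one> = x"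
  using F_closed G_carrier by (simp add: ract_eq_iff)

text \<open>The identity forms an orbit of its own under the right action of
  \<open>F\<close>.\<close>

lemma ract_eq_one_iff: "x \<in> G \<Longrightarrow> a \<in> F \<Longrightarrow> ract L F G x a = \<one> \<longleftrightarrow> x = \<one>"
  using F_Int_G G_carrier F_carrier G_closed F_closed
  by (auto simp: ract_eq_iff F_mult_cancel_right)

lemma ract_ract_inv:
  assumes "x \<in> G" "a \<in> F"
  shows "ract L F G (ract L F G x a) (inv a) = x"
proof -
  let ?y = "ract L F G x a"
  note y = ract_in[OF assms] lact_in[OF assms]
  have c: "x \<in> carrier L" "a \<in> carrier L" "?y \<in> carrier L"
    using assms y F_carrier G_carrier by auto
  have "?y \<otimes> inv a \<otimes> inv x = inv (x \<otimes> a \<otimes> inv ?y)"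
    using c by (simp add: inv_mult_group m_assoc)
  then show ?thesis
    using assms y F_closed by (simp add: ract_eq_iff lact_eq[OF assms, symmetric])
qed

text \<open>The first equation is the condition under which the product of
  \<open>p # (y \<rhd> a)\<close>, with \<open>p\<close> dual to \<open>inv y\<close>, and the basis
  element of \<open>(y, a)\<close> does not vanish. Both conditions amount to
  \<open>y \<lhd> a = inv y\<close>, and then \<open>lact_eq\<close> gives the value of
  \<open>y \<rhd> a\<close>.\<close>

lemma ract_self_inverse:
  assumes "y \<in> G" "a \<in> F"
  shows "y = ract L F G (inv y) (lact L F G y a) \<longleftrightarrow> y \<otimes> a \<otimes> y \<in> F"
    and "y \<otimes> a \<otimes> y \<in> F \<Longrightarrow> lact L F G y a = y \<otimes> a \<otimes> y"
proof -
  let ?z = "ract L F G y a"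
  note z = matched_pair[OF assms]
  have c: "y \<in> carrier L" "a \<in> carrier L" "?z \<in> carrier L"
    using assms z F_carrier G_carrier by auto
  have "y = ract L F G (inv y) (lact L F G y a) \<longleftrightarrow> inv y \<otimes> lact L F G y a \<otimes> inv y \<in> F"
    using ract_eq_iff[of "inv y" "lact L F G y a" y] assms z G_closed by metis
  also have "inv y \<otimes> lact L F G y a \<otimes> inv y = a \<otimes> (inv ?z \<otimes> inv y)"
  proof -
    have "inv y \<otimes> (y \<otimes> (a \<otimes> (inv ?z \<otimes> inv y))) = a \<otimes> (inv ?z \<otimes> inv y)"
      using c by (simp add: m_assoc[symmetric])
    then show ?thesis using c by (simp add: lact_eq[OF assms] m_assoc)
  qed
  also have "\<dots> \<in> F \<longleftrightarrow> inv ?z \<otimes> inv y \<in> F"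
    using assms c by (simp add: F_mult_cancel_left)
  also have "\<dots> \<longleftrightarrow> inv ?z \<otimes> inv y = \<one>"
    using F_Int_G G_closed z(2) assms(1) F_closed(3) by blast
  also have "\<dots> \<longleftrightarrow> ?z = inv y"
    using c by (metis inv_closed inv_equality inv_inv l_inv)
  also have "\<dots> \<longleftrightarrow> y \<otimes> a \<otimes> y \<in> F"
    using ract_eq_iff[OF assms, of "inv y"] assms(1) G_closed c by simp
  finally show "y = ract L F G (inv y) (lact L F G y a) \<longleftrightarrow> y \<otimes> a \<otimes> y \<in> F" .
  show "lact L F G y a = y \<otimes> a \<otimes> y" if "y \<otimes> a \<otimes> y \<in> F"
    using ract_eq_iff[OF assms, of "inv y"] that assms(1) G_closed c
    by (simp add: lact_eq[OF assms])
qed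

subsection \<open>The integral\<close>

lemma bismash_simps:
  "hbasis (bismash L F G) = G \<times> F"
  "mult_basis (bismash L F G) (x, a) (y, b) =
    (if y = ract L F G x a then basis_vec (x, a \<otimes> b) else (\<lambda>_. 0))"
  "hunit (bismash L F G) = (\<lambda>c. \<Sum>x\<in>G. basis_vec (x, \<one>) c)"
  "comult_basis (bismash L F G) (x, a) t =
    (\<Sum>y\<in>G. basis_vec ((x \<otimes> inv y, lact L F G y a), (y, a)) t)"
  "counit_basis (bismash L F G) (x, a) = (if x = \<one> then 1 else 0)"
  by (simp_all add: bismash_def)

text \<open>This is \<open>p\<^sub>1 # e\<close>, with \<open>e\<close> the averaging idempotent of
  the group algebra of \<open>F\<close>.\<close>

definition integral :: "'a \<times> 'a \<Rightarrow> 'k::field_char_0"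
  where "integral = (\<lambda>(x, a). if x = \<one> \<and> a \<in> F then 1 / of_nat (card F) else 0)"

lemma sum_integral:
  "(\<Sum>c\<in>G \<times> F. integral c * f c) = (\<Sum>a\<in>F. f (\<one>, a) / (of_nat (card F) :: 'k::field_char_0))"
proof -
  have "(\<Sum>c\<in>G \<times> F. integral c * f c) = (\<Sum>c\<in>{\<one>} \<times> F. integral c * f c)"
    by (rule sum.mono_neutral_right) (use finite_F finite_G G_closed in \<open>auto simp: integral_def split: if_splits\<close>)
  also have "\<dots> = (\<Sum>a\<in>F. f (\<one>, a) / of_nat (card F))"
    by (rule sum.reindex_bij_witness[of _ "\<lambda>a. (\<one>, a)" snd]) (auto simp: integral_def)
  finally show ?thesis .
qed

lemma sum_indicator_eq_integral:
  "(\<Sum>a\<in>F. (if d = (\<one>, a) then 1 else 0) / of_nat (card F)) = (integral d :: 'k::field_char_0)"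
proof -
  obtain x b where d: "d = (x, b)" by (cases d)
  have "(\<Sum>a\<in>F. (if d = (\<one>, a) then 1 else 0) / of_nat (card F)) =
      (\<Sum>a\<in>F. if a = b then if x = \<one> then 1 / of_nat (card F) else 0 else (0 :: 'k))"
    by (rule sum.cong) (auto simp: d)
  then show ?thesis using finite_F by (simp add: integral_def d)
qed

text \<open>Checked on basis elements: one lying over the identity of \<open>G\<close> translates
  the average over \<open>F\<close>, and any other gives 0, because the identity is fixed by the
  right action and reached only from itself.\<close>

lemma integral_is_integral:
  "is_integral (bismash L F G) (integral :: 'a \<times> 'a \<Rightarrow> 'k::field_char_0)"
proof -
  let ?H = "bismash L F G :: ('k, 'a \<times> 'a) hopf_data" and ?I = "integral :: 'a \<times> 'a \<Rightarrow> 'k"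
  let ?m = "mult_basis ?H"
  have left: "(\<Sum>c\<in>G \<times> F. ?I c * ?m b c d) = counit_basis ?H b * ?I d" if bG: "b \<in> G \<times> F" for b d
  proof -
    obtain x a where b: "b = (x, a)" "x \<in> G" "a \<in> F" using bG by auto
    show ?thesis
    proof (cases "x = \<one>")
      case True
      have r: "ract L F G \<one> a = \<one>" using ract_eq_one_iff b(3) G_closed by simp
      have "(\<Sum>c\<in>G \<times> F. ?I c * ?m b c d) = (\<Sum>a'\<in>F. ?m b (\<one>, a') d / of_nat (card F))"
        by (rule sum_integral)
      also have "\<dots> = (\<Sum>a'\<in>F. (if d = (\<one>, a \<otimes> a') then 1 else 0) / of_nat (card F))"
        by (simp add: b True r bismash_simps basis_vec_def)
      also have "\<dots> = (\<Sum>a'\<in>F. (if d = (\<one>, a') then 1 else 0) / of_nat (card F))"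
        by (rule sum.reindex_bij_witness[of _ "\<lambda>a'. inv a \<otimes> a'" "\<lambda>a'. a \<otimes> a'"])
          (use b(3) F_carrier F_closed in \<open>auto simp: m_assoc[symmetric]\<close>)
      also have "\<dots> = ?I d"
        by (rule sum_indicator_eq_integral)
      finally show ?thesis using True b by (simp add: bismash_simps)
    next
      case False
      then have "\<one> \<noteq> ract L F G x a" using ract_eq_one_iff b by metis
      then show ?thesis using False b by (simp add: sum_integral bismash_simps)
    qed
  qed
  have right: "(\<Sum>c\<in>G \<times> F. ?I c * ?m c b d) = counit_basis ?H b * ?I d" if bG: "b \<in> G \<times> F" for b d
  proof -
    obtain x a where b: "b = (x, a)" "x \<in> G" "a \<in> F" using bG by auto
    have r: "ract L F G \<one> a' = \<one>" if "a' \<in> F" for a' using ract_eq_one_iff that G_closed by simp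
    have "(\<Sum>c\<in>G \<times> F. ?I c * ?m c b d) = (\<Sum>a'\<in>F. ?m (\<one>, a') b d / of_nat (card F))"
      by (rule sum_integral)
    also have "\<dots> = counit_basis ?H b * (\<Sum>a'\<in>F. (if d = (\<one>, a' \<otimes> a) then 1 else 0) / of_nat (card F))"
      unfolding sum_distrib_left
      by (rule sum.cong) (auto simp: b r bismash_simps basis_vec_def)
    also have "(\<Sum>a'\<in>F. (if d = (\<one>, a' \<otimes> a) then 1 else 0) / of_nat (card F)) =
        (\<Sum>a'\<in>F. (if d = (\<one>, a') then 1 else 0) / (of_nat (card F) :: 'k))"
      by (rule sum.reindex_bij_witness[of _ "\<lambda>a'. a' \<otimes> inv a" "\<lambda>a'. a' \<otimes> a"])
        (use b(3) F_carrier F_closed in \<open>auto simp: m_assoc\<close>)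
    also have "\<dots> = ?I d"
      by (rule sum_indicator_eq_integral)
    finally show ?thesis .
  qed
  have "?I \<in> hcarrier ?H"
    using G_closed by (auto simp: hcarrier_def bismash_simps integral_def)
  moreover have "hmult ?H h ?I = (\<lambda>d. hcounit ?H h * ?I d)" for h
  proof
    fix d
    have "hmult ?H h ?I d = (\<Sum>b\<in>G \<times> F. h b * (\<Sum>c\<in>G \<times> F. ?I c * ?m b c d))"
      by (simp add: hmult_def hmult_tensor_def bismash_simps(1) sum_distrib_left mult.assoc)
    also have "\<dots> = hcounit ?H h * ?I d"
      by (simp add: left hcounit_def bismash_simps(1) sum_distrib_right mult.assoc)
    finally show "hmult ?H h ?I d = hcounit ?H h * ?I d" .
  qed
  moreover have "hmult ?H ?I h = (\<lambda>d. hcounit ?H h * ?I d)" for h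
  proof
    fix d
    have "hmult ?H ?I h d = (\<Sum>b\<in>G \<times> F. \<Sum>c\<in>G \<times> F. h c * (?I b * ?m b c d))"
      by (simp add: hmult_def hmult_tensor_def bismash_simps(1) mult.assoc mult.left_commute)
    also have "\<dots> = (\<Sum>c\<in>G \<times> F. h c * (\<Sum>b\<in>G \<times> F. ?I b * ?m b c d))"
      by (subst sum.swap) (simp add: sum_distrib_left)
    also have "\<dots> = hcounit ?H h * ?I d"
      by (simp add: right hcounit_def bismash_simps(1) sum_distrib_right mult.assoc)
    finally show "hmult ?H ?I h d = hcounit ?H h * ?I d" .
  qed
  ultimately show ?thesis by (simp add: is_integral_def)
qed

text \<open>For another normalized integral \<open>t\<close>, the product of \<open>t\<close> with
  \<open>integral\<close> is a counit multiple of each of the two, both with factor 1, so they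
  agree.\<close>

lemma normalized_integral_eq:
  "normalized_integral (bismash L F G) = (integral :: 'a \<times> 'a \<Rightarrow> 'k::field_char_0)"
proof -
  let ?H = "bismash L F G :: ('k, 'a \<times> 'a) hopf_data" and ?I = "integral :: 'a \<times> 'a \<Rightarrow> 'k"
  have "hcounit ?H ?I = 1"
    using card_F_gt_0 by (simp add: hcounit_def bismash_simps sum_integral)
  moreover have "t = ?I" if t: "is_integral ?H t" "hcounit ?H t = 1" for t
  proof -
    have "hmult ?H t ?I = (\<lambda>b. hcounit ?H t * ?I b)" "hmult ?H t ?I = (\<lambda>b. hcounit ?H ?I * t b)"
      using t(1) integral_is_integral[where 'k = 'k] unfolding is_integral_def by blast+
    then show ?thesis using t(2) \<open>hcounit ?H ?I = 1\<close> by (simp add: fun_eq_iff)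
  qed
  ultimately show ?thesis
    unfolding normalized_integral_def using integral_is_integral by (intro the_equality) auto
qed

text \<open>In Sweedler notation this is \<open>\<Sum>\<Lambda>\<^sub>1 \<Lambda>\<^sub>2\<close>.\<close>

lemma hmult_tensor_comult_integral:
  "hmult_tensor (bismash L F G) (hcomult (bismash L F G) integral) =
    (\<lambda>d. \<Sum>(y, a)\<in>{(y, a). y \<in> G \<and> a \<in> F \<and> y \<otimes> a \<otimes> y \<in> F}.
      (1 / of_nat (card F)) * basis_vec (inv y, y \<otimes> a \<otimes> y \<otimes> a) d :: 'k::field_char_0)"
proof -
  let ?H = "bismash L F G :: ('k, 'a \<times> 'a) hopf_data" and ?c = "1 / of_nat (card F) :: 'k"
  let ?p = "\<lambda>(y, a). (inv y, lact L F G y a)"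
  let ?P = "{(y, a). y \<in> G \<and> a \<in> F \<and> y \<otimes> a \<otimes> y \<in> F}"
  have "hcomult ?H integral = (\<lambda>t. \<Sum>i\<in>G \<times> F. ?c * basis_vec (?p i, i) t)"
  proof
    fix t
    have "hcomult ?H integral t = (\<Sum>a\<in>F. comult_basis ?H (\<one>, a) t / of_nat (card F))"
      by (simp add: hcomult_def bismash_simps(1) sum_integral)
    also have "\<dots> = (\<Sum>a\<in>F. \<Sum>y\<in>G. ?c * basis_vec (?p (y, a), (y, a)) t)"
      by (rule sum.cong) (simp_all add: bismash_simps sum_divide_distrib G_carrier)
    also have "\<dots> = (\<Sum>i\<in>G \<times> F. ?c * basis_vec (?p i, i) t)"
      by (subst sum.swap) (simp add: sum.cartesian_product case_prod_beta)
    finally show "hcomult ?H integral t = (\<Sum>i\<in>G \<times> F. ?c * basis_vec (?p i, i) t)" .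
  qed
  then have "hmult_tensor ?H (hcomult ?H integral) =
      (\<lambda>d. \<Sum>i\<in>G \<times> F. ?c * mult_basis ?H (?p i) i d)"
    using hmult_tensor_basis[of ?H "G \<times> F" ?p "\<lambda>i. i" ?c] finite_F finite_G G_closed lact_in
    by (auto simp: bismash_simps(1))
  also have "\<dots> = (\<lambda>d. \<Sum>(y, a)\<in>?P. ?c * basis_vec (inv y, y \<otimes> a \<otimes> y \<otimes> a) d)"
  proof
    fix d
    have "(\<Sum>i\<in>G \<times> F. ?c * mult_basis ?H (?p i) i d) = (\<Sum>i\<in>?P. ?c * mult_basis ?H (?p i) i d)"
      by (rule sum.mono_neutral_right)
        (use finite_F finite_G ract_self_inverse(1) in \<open>auto simp: bismash_simps split: if_splits\<close>)
    also have "\<dots> = (\<Sum>(y, a)\<in>?P. ?c * basis_vec (inv y, y \<otimes> a \<otimes> y \<otimes> a) d)"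
    proof (rule sum.cong[OF refl])
      fix i assume "i \<in> ?P"
      then obtain y a where i: "i = (y, a)" and "y \<in> G" "a \<in> F" "y \<otimes> a \<otimes> y \<in> F" by blast
      then show "?c * mult_basis ?H (?p i) i d =
          (case i of (y, a) \<Rightarrow> ?c * basis_vec (inv y, y \<otimes> a \<otimes> y \<otimes> a) d)"
        using ract_self_inverse[of y a] by (simp add: bismash_simps)
    qed
    finally show "(\<Sum>i\<in>G \<times> F. ?c * mult_basis ?H (?p i) i d) =
        (\<Sum>(y, a)\<in>?P. ?c * basis_vec (inv y, y \<otimes> a \<otimes> y \<otimes> a) d)" .
  qed
  finally show ?thesis .
qed

end

subsection \<open>Simple modules\<close>

locale simple_bismash_module = factorized_group L F G + simple_hopf_module scale "bismash L F G" act
  for L :: "('a, 'm) monoid_scheme" (structure) and F G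
    and scale :: "'k::{alg_closed_field, field_char_0} \<Rightarrow> 'v::ab_group_add \<Rightarrow> 'v" (infixr \<open>*s\<close> 75)
    and act :: "('a \<times> 'a \<Rightarrow> 'k) \<Rightarrow> 'v \<Rightarrow> 'v"
begin

abbreviation H :: "('k, 'a \<times> 'a) hopf_data"
  where "H \<equiv> bismash L F G"

definition act_basis :: "'a \<Rightarrow> 'a \<Rightarrow> 'v \<Rightarrow> 'v"
  where "act_basis x a = act (basis_vec (x, a))"

text \<open>The space \<open>p\<^sub>x V\<close>, described as the fixed space of an
  idempotent.\<close>

definition component :: "'a \<Rightarrow> 'v set"
  where "component x = {v. act_basis x \<one> v = v}"

lemma basis_vec_carrier: "x \<in> G \<Longrightarrow> a \<in> F \<Longrightarrow> basis_vec (x, a) \<in> hcarrier H"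
  by (auto simp: hcarrier_def basis_vec_def bismash_simps(1))

lemma act_zero: "act (\<lambda>_. 0) v = 0"
  using act_scale_left[of "\<lambda>_. 0" 0 v] by (simp add: hcarrier_def)

lemma act_sum:
  assumes "\<And>i. i \<in> I \<Longrightarrow> h i \<in> hcarrier H"
  shows "act (\<lambda>b. \<Sum>i\<in>I. h i b) v = (\<Sum>i\<in>I. act (h i) v)"
  using assms
proof (induction I rule: infinite_finite_induct)
  case (insert i I)
  then have "(\<lambda>b. \<Sum>i\<in>I. h i b) \<in> hcarrier H" by (auto simp: hcarrier_def)
  then show ?case using insert by (simp add: act_add_left)
qed (simp_all add: act_zero)

lemma act_sum_basis:
  assumes "\<And>i. i \<in> I \<Longrightarrow> x i \<in> G \<and> a i \<in> F"
  shows "act (\<lambda>b. \<Sum>i\<in>I. c i * basis_vec (x i, a i) b) v = (\<Sum>i\<in>I. c i *s act_basis (x i) (a i) v)"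
proof -
  have "basis_vec (x i, a i) \<in> hcarrier H" if "i \<in> I" for i
    using assms[OF that] basis_vec_carrier by blast
  moreover from this have "(\<lambda>b. c i * basis_vec (x i, a i) b) \<in> hcarrier H" if "i \<in> I" for i
    using that by (simp add: hcarrier_def)
  ultimately show ?thesis by (simp add: act_sum act_scale_left act_basis_def)
qed

lemma act_expand:
  assumes "h \<in> hcarrier H"
  shows "act h v = (\<Sum>(x, a)\<in>G \<times> F. h (x, a) *s act_basis x a v)"
proof -
  have "h = (\<lambda>b. \<Sum>i\<in>G \<times> F. h i * basis_vec (fst i, snd i) b)"
  proof
    fix b
    have "(\<Sum>i\<in>G \<times> F. h i * basis_vec (fst i, snd i) b) = (\<Sum>i\<in>G \<times> F. if i = b then h b else 0)"
      by (rule sum.cong) (auto simp: basis_vec_def)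
    also have "\<dots> = h b"
      using assms finite_F finite_G by (cases b) (auto simp: hcarrier_def bismash_simps(1))
    finally show "h b = (\<Sum>i\<in>G \<times> F. h i * basis_vec (fst i, snd i) b)" by (rule sym)
  qed
  then have "act h v = act (\<lambda>b. \<Sum>i\<in>G \<times> F. h i * basis_vec (fst i, snd i) b) v"
    by (rule arg_cong[of _ _ "\<lambda>h. act h v"])
  also have "\<dots> = (\<Sum>i\<in>G \<times> F. h i *s act_basis (fst i) (snd i) v)"
    by (rule act_sum_basis) auto
  finally show ?thesis by (simp add: case_prod_beta)
qed

lemma act_basis_add: "x \<in> G \<Longrightarrow> a \<in> F \<Longrightarrow> act_basis x a (u + v) = act_basis x a u + act_basis x a v"
  and act_basis_scale: "x \<in> G \<Longrightarrow> a \<in> F \<Longrightarrow> act_basis x a (c *s v) = c *s act_basis x a v"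
  by (simp_all add: act_basis_def act_add_right act_scale_right basis_vec_carrier)

lemma act_basis_zero: "x \<in> G \<Longrightarrow> a \<in> F \<Longrightarrow> act_basis x a 0 = 0"
  using act_basis_scale[of x a 0 0] by simp

lemma act_basis_mult:
  assumes "x \<in> G" "a \<in> F" "y \<in> G" "b \<in> F"
  shows "act_basis x a (act_basis y b v) = (if y = ract L F G x a then act_basis x (a \<otimes> b) v else 0)"
proof -
  \<comment> \<open>A sum over a one-element index set brings a single elementary tensor into the
    shape of \<open>hmult_tensor_basis\<close>.\<close>
  have "(\<lambda>(c, d). basis_vec (x, a) c * basis_vec (y, b) d) =
      (\<lambda>t. \<Sum>i\<in>{()}. 1 * basis_vec ((x, a), (y, b)) t :: 'k)"
    by (auto simp: basis_vec_def fun_eq_iff)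
  then have "hmult H (basis_vec (x, a)) (basis_vec (y, b)) =
      (\<lambda>d. \<Sum>i\<in>{()}. 1 * mult_basis H (x, a) (y, b) d)"
    unfolding hmult_def using assms finite_F finite_G
    by (simp only:) (subst hmult_tensor_basis, auto simp: bismash_simps(1))
  then have "act_basis x a (act_basis y b v) = act (mult_basis H (x, a) (y, b)) v"
    using assms by (simp add: act_basis_def act_mult[symmetric] basis_vec_carrier)
  then show ?thesis by (simp add: bismash_simps act_zero act_basis_def)
qed

lemma sum_act_basis_one: "(\<Sum>x\<in>G. act_basis x \<one> v) = v"
  using act_unit[of v] act_sum_basis[of G "\<lambda>x. x" "\<lambda>_. \<one>" "\<lambda>_. 1" v] F_closed(3)
  by (simp add: bismash_simps)

lemma act_basis_in_component: "x \<in> G \<Longrightarrow> a \<in> F \<Longrightarrow> act_basis x a v \<in> component x"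
  using F_closed(3) by (simp add: component_def act_basis_mult ract_one F_carrier)

lemma act_basis_component:
  assumes "x \<in> G" "a \<in> F" "y \<in> G" "v \<in> component y"
  shows "act_basis x a v = (if y = ract L F G x a then act_basis x a v else 0)"
proof -
  have "act_basis x a v = act_basis x a (act_basis y \<one> v)"
    using assms(4) by (simp add: component_def)
  also have "\<dots> = (if y = ract L F G x a then act_basis x a v else 0)"
    using assms F_closed(3) by (simp add: act_basis_mult F_carrier)
  finally show ?thesis .
qed

lemma subspace_component: "x \<in> G \<Longrightarrow> subspace (component x)"
  using F_closed(3) by (simp add: subspace_def component_def act_basis_add act_basis_scale act_basis_zero)

lemma submoduleI:
  assumes "subspace U" "\<And>x a u. x \<in> G \<Longrightarrow> a \<in> F \<Longrightarrow> u \<in> U \<Longrightarrow> act_basis x a u \<in> U"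
  shows "submodule U"
  unfolding submodule_def
  using assms by (auto simp: act_expand intro!: subspace_sum subspace_scale)

text \<open>A nonzero vector generates a simple module, so its finitely many images under the basis
  of the algebra span the whole space.\<close>

lemma exists_basis: "\<exists>Basis. fd_space (*s) Basis"
proof -
  obtain v :: 'v where v: "v \<noteq> 0" using nonzero by blast
  let ?S = "(\<lambda>(x, a). act_basis x a v) ` (G \<times> F)"
  have "submodule (span ?S)"
  proof (rule submoduleI)
    fix x a u assume xa: "x \<in> G" "a \<in> F" and "u \<in> span ?S"
    from this(3) show "act_basis x a u \<in> span ?S"
    proof (induction rule: span_induct_alt)
      case base
      then show ?case using xa by (simp add: act_basis_zero span_zero)
    next
      case (step c s w)
      then obtain y b where s: "s = act_basis y b v" "y \<in> G" "b \<in> F" by auto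
      have "act_basis x a s \<in> span ?S"
        using xa s F_closed by (auto simp: act_basis_mult span_zero intro!: span_base)
      then show ?case using step xa by (simp add: act_basis_add act_basis_scale span_add span_scale)
    qed
  qed simp
  moreover have "v \<in> span ?S"
    using sum_act_basis_one[of v] F_closed(3)
    by (metis (mono_tags, lifting) SigmaI case_prod_conv image_eqI span_base span_sum)
  ultimately have S: "span ?S = UNIV" using simple[of "span ?S"] v by auto
  obtain B where B: "B \<subseteq> ?S" "independent B" "?S \<subseteq> span B"
    using maximal_independent_subset[of ?S] by blast
  have "span B = UNIV" using B(3) S by (metis UNIV_I span_minimal subsetI subset_antisym subspace_span)
  moreover have "finite B" using B(1) finite_F finite_G by (meson finite_SigmaI finite_imageI finite_subset)
  ultimately have "fd_space (*s) B"
    using B(2) by unfold_locales auto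
  then show ?thesis by blast
qed

definition some_basis :: "'v set"
  where "some_basis = (SOME Basis. fd_space (*s) Basis)"

sublocale fd_space "(*s)" some_basis
  unfolding some_basis_def using exists_basis by (rule someI_ex)

lemma endo_act_basis: "x \<in> G \<Longrightarrow> a \<in> F \<Longrightarrow> endo (act_basis x a)"
  by (rule endoI) (simp_all add: act_basis_add act_basis_scale)

text \<open>Each term of the element \<open>\<Sum>\<Lambda>\<^sub>1 \<Lambda>\<^sub>2\<close> is a
  multiple of a basis element lying over \<open>inv y\<close>. Its image is contained in that
  component, so its trace on \<open>V\<close> can be taken there.\<close>

theorem fs_indicator_eq:
  "fs_indicator H (module_character (*s) act) =
    (\<Sum>y\<in>G. \<Sum>a\<in>{a \<in> F. y \<otimes> a \<otimes> y \<in> F}.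
      trace_on (component (inv y)) (act_basis (inv y) (y \<otimes> a \<otimes> y \<otimes> a))) / of_nat (card F)"
proof -
  let ?P = "Sigma G (\<lambda>y. {a \<in> F. y \<otimes> a \<otimes> y \<in> F})"
  let ?c = "1 / of_nat (card F) :: 'k"
  let ?T = "\<lambda>(y, a). act_basis (inv y) (y \<otimes> a \<otimes> y \<otimes> a)"
  let ?w = "hmult_tensor H (hcomult H (normalized_integral H))"
  have P: "inv (fst i) \<in> G \<and> fst i \<otimes> snd i \<otimes> fst i \<otimes> snd i \<in> F" if "i \<in> ?P" for i
    using that G_closed F_closed by auto
  have w: "?w = (\<lambda>d. \<Sum>i\<in>?P. ?c * basis_vec (inv (fst i), fst i \<otimes> snd i \<otimes> fst i \<otimes> snd i) d)"
    unfolding normalized_integral_eq hmult_tensor_comult_integral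
    by (rule ext, rule sum.cong) auto
  have T: "endo (?T i)" "?T i v \<in> component (inv (fst i))" if "i \<in> ?P" for i v
    using P[OF that] endo_act_basis act_basis_in_component by (auto simp: case_prod_beta)
  have "act ?w = (\<lambda>v. \<Sum>i\<in>?P. ?c *s ?T i v)"
    unfolding w using P by (intro ext, subst act_sum_basis) (auto simp: case_prod_beta)
  moreover have eT: "endo (\<lambda>v. ?c *s ?T i v)" if "i \<in> ?P" for i
    by (rule endo_comp[OF linear_scale_self T(1)[OF that]])
  ultimately have "module_character (*s) act ?w = trace_on UNIV (\<lambda>v. \<Sum>i\<in>?P. ?c *s ?T i v)"
    unfolding module_character_def by (subst linear_trace_eq_trace_on[OF subspace_UNIV])
      (auto intro!: endo_sum_fun)
  also have "\<dots> = (\<Sum>i\<in>?P. trace_on UNIV (\<lambda>v. ?c *s ?T i v))"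
    by (rule trace_on_sum[OF subspace_UNIV eT]) auto
  also have "\<dots> = (\<Sum>i\<in>?P. ?c * trace_on (component (inv (fst i))) (?T i))"
  proof (rule sum.cong[OF refl])
    fix i assume i: "i \<in> ?P"
    have "trace_on UNIV (\<lambda>v. ?c *s ?T i v) = ?c * trace_on UNIV (?T i)"
      by (rule trace_on_scale[OF subspace_UNIV T(1)[OF i]]) simp
    also have "trace_on UNIV (?T i) = linear_trace (*s) (?T i)"
      by (rule linear_trace_eq_trace_on[OF subspace_UNIV T(1)[OF i], symmetric]) simp
    also have "\<dots> = trace_on (component (inv (fst i))) (?T i)"
      using P[OF i] by (intro linear_trace_eq_trace_on subspace_component T[OF i]) auto
    finally show "trace_on UNIV (\<lambda>v. ?c *s ?T i v) = ?c * trace_on (component (inv (fst i))) (?T i)" .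
  qed
  also have "\<dots> = (\<Sum>i\<in>?P. trace_on (component (inv (fst i))) (?T i)) / of_nat (card F)"
    by (simp add: sum_divide_distrib)
  also have "(\<Sum>i\<in>?P. trace_on (component (inv (fst i))) (?T i)) =
      (\<Sum>y\<in>G. \<Sum>a\<in>{a \<in> F. y \<otimes> a \<otimes> y \<in> F}.
        trace_on (component (inv y)) (act_basis (inv y) (y \<otimes> a \<otimes> y \<otimes> a)))"
    using finite_F finite_G by (subst sum.Sigma) (auto intro!: sum.cong)
  finally show ?thesis by (simp add: fs_indicator_def)
qed

section \<open>Components as representations of stabilizers\<close>

text \<open>The vectors sent into \<open>U\<close> by every basis element over \<open>x\<close> form
  a submodule. It contains \<open>U\<close>, as a basis element whose \<open>a\<close> does not
  stabilize \<open>x\<close> kills the component. So it is everything, and applying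
  \<open>p\<^sub>x\<close> gives the claim.\<close>

lemma component_irreducible:
  assumes x: "x \<in> G" and U: "subspace U" "U \<subseteq> component x" "U \<noteq> {0}"
    and stable: "\<And>a u. a \<in> F \<Longrightarrow> ract L F G x a = x \<Longrightarrow> u \<in> U \<Longrightarrow> act_basis x a u \<in> U"
  shows "U = component x"
proof -
  let ?S = "{v. \<forall>a\<in>F. act_basis x a v \<in> U}"
  have "subspace ?S"
    using U(1) x by (auto simp: subspace_def act_basis_add act_basis_scale act_basis_zero)
  then have "submodule ?S"
    by (rule submoduleI) (use x U(1) F_closed in \<open>auto simp: act_basis_mult subspace_0\<close>)
  moreover have "U \<subseteq> ?S"
  proof safe
    fix u a assume u: "u \<in> U" and a: "a \<in> F"
    then show "act_basis x a u \<in> U"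
      using act_basis_component[OF x a x, of u] U(2) stable[OF a _ u] subspace_0[OF U(1)]
      by (auto split: if_splits)
  qed
  moreover have "\<exists>u\<in>U. u \<noteq> 0" using U(1,3) subspace_0 by blast
  ultimately have "?S = UNIV" using simple by blast
  then have "act_basis x \<one> v \<in> U" for v using F_closed(3) by blast
  then have "v \<in> U" if "v \<in> component x" for v
    using that by (metis (mono_tags) component_def mem_Collect_eq)
  then show ?thesis using U(2) by blast
qed

text \<open>Acting by \<open>a\<close> maps the component of \<open>x \<lhd> a\<close> injectively
  to that of \<open>x\<close>, since \<open>inv a\<close> acts backwards. Vanishing therefore
  spreads along orbits.\<close>

lemma component_ract_eq_0:
  assumes "x \<in> G" "a \<in> F" "component x = {0}"
  shows "component (ract L F G x a) = {0}"
proof -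
  let ?y = "ract L F G x a"
  have y: "?y \<in> G" "inv a \<in> F" using assms ract_in F_closed by auto
  have "v = 0" if v: "v \<in> component ?y" for v
  proof -
    have "act_basis x a v = 0" using act_basis_in_component[OF assms(1,2)] assms(3) by blast
    then have "act_basis ?y (inv a) (act_basis x a v) = 0" using y by (simp add: act_basis_zero)
    then have "act_basis ?y \<one> v = 0"
      using assms y by (simp add: act_basis_mult ract_ract_inv F_carrier)
    then show ?thesis using v by (simp add: component_def)
  qed
  then show ?thesis using subspace_0[OF subspace_component[OF y(1)]] by blast
qed

text \<open>As the identity is an orbit of its own, its component is a submodule, hence all of
  \<open>V\<close>; the other idempotents then act as 0.\<close>

lemma component_eq_0_if_component_one:
  assumes "component \<one> \<noteq> {0}" "x \<in> G" "x \<noteq> \<one>"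
  shows "component x = {0}"
proof -
  have 1: "\<one> \<in> G" "\<one> \<in> F" using G_closed F_closed by auto
  have "submodule (component \<one>)"
  proof (rule submoduleI[OF subspace_component[OF 1(1)]])
    fix y b v assume *: "y \<in> G" "b \<in> F" "v \<in> component \<one>"
    show "act_basis y b v \<in> component \<one>"
    proof (cases "y = \<one>")
      case True
      then show ?thesis using act_basis_in_component * by blast
    next
      case False
      then have "\<one> \<noteq> ract L F G y b" using ract_eq_one_iff * by metis
      then have "act_basis y b v = 0" using act_basis_component[OF *(1,2) 1(1) *(3)] by simp
      then show ?thesis using subspace_0[OF subspace_component[OF 1(1)]] by simp
    qed
  qed
  then have U: "component \<one> = UNIV" using simple assms(1) by blast
  have "v = 0" if v: "v \<in> component x" for v
  proof -
    have "act_basis x \<one> v = 0"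
      using act_basis_component[OF assms(2) 1(2) 1(1), of v] U assms ract_one by simp
    then show ?thesis using v by (simp add: component_def)
  qed
  then show ?thesis using subspace_0[OF subspace_component[OF assms(2)]] by blast
qed

lemma component_exists: "\<exists>x\<in>G. component x \<noteq> {0}"
proof (rule ccontr)
  assume *: "\<not> (\<exists>x\<in>G. component x \<noteq> {0})"
  have "v = 0" for v :: 'v
  proof -
    have "act_basis x \<one> v = 0" if "x \<in> G" for x
      using act_basis_in_component[OF that F_closed(3)] * that by blast
    then show ?thesis using sum_act_basis_one[of v] by simp
  qed
  then show False using nonzero by blast
qed

end

section \<open>The factorization of the symmetric group\<close>

lemma sym_group_eq_perm_group: "sym_group n = perm_group {1..n}"
  by (simp add: sym_group_def perm_group_def)

lemma mem_point_stabilizer: "p \<in> point_stabilizer n \<longleftrightarrow> p permutes {1..n} \<and> p n = n"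
  by (simp add: point_stabilizer_def sym_group_carrier)

lemma cycle_permutes_interval: "cycle_of_list [1..<Suc n] permutes {1..n}"
  using cycle_permutes[of "[1..<Suc n]"] by (simp add: atLeastLessThanSuc_atLeastAtMost del: upt_Suc)

lemma subgroup_cyclic_subgroup: "subgroup (cyclic_subgroup n) (sym_group n)"
  unfolding cyclic_subgroup_def
  by (rule group.generate_is_subgroup[OF sym_group_is_group])
    (use cycle_permutes_interval in \<open>auto simp: sym_group_carrier\<close>)

lemma cyclic_subgroup_permutes: "g \<in> cyclic_subgroup n \<Longrightarrow> g permutes {1..n}"
  using subgroup.mem_carrier[OF subgroup_cyclic_subgroup] by (simp add: sym_group_carrier)

lemma cyclic_subgroup_commute:
  assumes "g \<in> cyclic_subgroup n"
  shows "g \<circ> cycle_of_list [1..<Suc n] = cycle_of_list [1..<Suc n] \<circ> g"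
  using assms unfolding cyclic_subgroup_def
proof (induction rule: generate.induct)
  case (inv h)
  then have h: "h = cycle_of_list [1..<Suc n]" "h permutes {1..n}"
    using cycle_permutes_interval[of n] by auto
  then have "inv\<^bsub>sym_group n\<^esub> h = inv' h" by (simp add: sym_group_carrier)
  then show ?case
    unfolding h(1)[symmetric] using permutes_inv_o[OF h(2)] by simp
next
  case (eng g h)
  then show ?case by (simp add: sym_group_mult fun_eq_iff)
qed (simp_all add: sym_group_one)

lemma funpow_cycle_in: "cycle_of_list [1..<Suc n] ^^ k \<in> cyclic_subgroup n"
proof (induction k)
  case 0
  show ?case
    using subgroup.one_closed[OF subgroup_cyclic_subgroup[of n]]
    unfolding funpow.simps(1) sym_group_one .
next
  case (Suc k)
  have "cycle_of_list [1..<Suc n] \<in> cyclic_subgroup n"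
    unfolding cyclic_subgroup_def by (rule generate.incl) simp
  then show ?case
    using subgroup.m_closed[OF subgroup_cyclic_subgroup _ Suc] unfolding sym_group_mult funpow.simps(2) by blast
qed

lemma funpow_cycle_last:
  assumes "i \<in> {1..n}"
  shows "(cycle_of_list [1..<Suc n] ^^ i) n = i"
proof -
  let ?cs = "[1..<Suc n]"
  \<comment> \<open>Lists are indexed from 0: \<open>n\<close> stands at position
    \<open>n - 1\<close>, and rotation by \<open>i\<close> brings there the entry of position
    \<open>i - 1\<close>, which is \<open>i\<close>.\<close>
  have n: "n - 1 < length ?cs" "?cs ! (n - 1) = n" using assms by (auto simp del: upt_Suc)
  have "(cycle_of_list ?cs ^^ i) n = map (cycle_of_list ?cs ^^ i) ?cs ! (n - 1)"
    using n by (simp del: upt_Suc)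
  also have "\<dots> = rotate i ?cs ! (n - 1)"
    using cyclic_rotation[of ?cs i] by simp
  also have "\<dots> = ?cs ! ((i + (n - 1)) mod n)"
    using nth_rotate[OF n(1), of i] by (simp del: upt_Suc)
  also have "(i + (n - 1)) mod n = i - 1"
    using assms by (cases i) (auto simp: mod_if)
  also have "?cs ! (i - 1) = i" using assms by (simp del: upt_Suc)
  finally show ?thesis .
qed

lemma cyclic_subgroup_transitive:
  assumes "i \<in> {1..n}"
  obtains g where "g \<in> cyclic_subgroup n" "g n = i"
  using that funpow_cycle_last[OF assms] funpow_cycle_in by blast

text \<open>An element of \<open>C\<^sub>n\<close> commutes with the powers of the cycle, which act transitively.\<close>

lemma cyclic_subgroup_eqI:
  assumes g: "g \<in> cyclic_subgroup n" and h: "h \<in> cyclic_subgroup n" and eq: "g n = h n"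
  shows "g = h"
proof
  fix i
  show "g i = h i"
  proof (cases "i \<in> {1..n}")
    case True
    let ?c = "cycle_of_list [1..<Suc n]"
    have "f ((?c ^^ k) n) = (?c ^^ k) (f n)" if "f \<in> cyclic_subgroup n" for f k
      using cyclic_subgroup_commute[OF that] by (induction k) (simp_all add: fun_eq_iff del: upt_Suc)
    then show ?thesis using g h eq funpow_cycle_last[OF True] by metis
  next
    case False
    then show ?thesis using cyclic_subgroup_permutes[OF g] cyclic_subgroup_permutes[OF h]
      by (simp add: permutes_not_in)
  qed
qed

text \<open>Evaluation at \<open>n\<close> is injective on the subgroup and reaches every point of
  \<open>{1..n}\<close>.\<close>

lemma card_cyclic_subgroup:
  assumes "n \<ge> 1"
  shows "card (cyclic_subgroup n) = n"
proof -
  have "bij_betw (\<lambda>g. g n) (cyclic_subgroup n) {1..n}"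
    unfolding bij_betw_def inj_on_def
  proof safe
    fix g assume "g \<in> cyclic_subgroup n"
    then show "g n \<in> {1..n}"
      using cyclic_subgroup_permutes permutes_in_image[of g "{1..n}" n] assms by auto
  next
    fix i assume "i \<in> {1..n}"
    then show "i \<in> (\<lambda>g. g n) ` cyclic_subgroup n" using cyclic_subgroup_transitive by blast
  qed (rule cyclic_subgroup_eqI)
  then show ?thesis using bij_betw_same_card by fastforce
qed

text \<open>The case \<open>i = j\<close> is included, so that one lemma covers stabilizers of one
  point and of two.\<close>

lemma permutes_Diff_iff:
  assumes "i \<in> A" "j \<in> A"
  shows "p permutes (A - {i, j}) \<longleftrightarrow> p permutes A \<and> p i = i \<and> p j = j"
proof
  assume p: "p permutes (A - {i, j})"
  have "p permutes A" by (rule permutes_subset[OF p]) blast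
  moreover have "p i = i" "p j = j" by (rule permutes_not_in[OF p], simp)+
  ultimately show "p permutes A \<and> p i = i \<and> p j = j" by blast
next
  assume p: "p permutes A \<and> p i = i \<and> p j = j"
  show "p permutes (A - {i, j})"
    by (rule permutes_superset[of p A]) (use p in auto)
qed

lemma point_stabilizer_eq:
  assumes "n \<ge> 1"
  shows "point_stabilizer n = {p. p permutes ({1..n} - {n})}"
proof (rule Set.set_eqI)
  fix p
  have "n \<in> {1..n}" using assms by simp
  from permutes_Diff_iff[OF this this, of p]
  show "p \<in> point_stabilizer n \<longleftrightarrow> p \<in> {p. p permutes ({1..n} - {n})}"
    by (simp only: mem_point_stabilizer insert_absorb2 mem_Collect_eq conj_absorb)
qed

lemma card_point_stabilizer:
  assumes "n \<ge> 1"
  shows "card (point_stabilizer n) = fact (n - 1)"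
  unfolding point_stabilizer_eq[OF assms] using assms by (intro card_permutations) auto

text \<open>If \<open>y\<close> in the cyclic subgroup sends \<open>n\<close> to the preimage of
  \<open>n\<close> under \<open>g\<close>, then \<open>g \<circ> y\<close> fixes \<open>n\<close>
  and \<open>g = (g \<circ> y) \<circ> inv' y\<close>. The intersection is trivial because an
  element of the cyclic subgroup is determined by its value at \<open>n\<close>.\<close>

lemma factorized_sym_group:
  assumes "n \<ge> 1"
  shows "factorized_group (sym_group n) (point_stabilizer n) (cyclic_subgroup n)"
proof (intro factorized_group.intro factorized_group_axioms.intro)
  show "group (sym_group n)" by (rule sym_group_is_group)
  show "subgroup (cyclic_subgroup n) (sym_group n)" by (rule subgroup_cyclic_subgroup)
  show "subgroup (point_stabilizer n) (sym_group n)"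
    unfolding point_stabilizer_eq[OF assms] sym_group_eq_perm_group
    by (rule subgroup_perm_group) auto
  have fin: "finite {p. p permutes {1..n}}" by (rule finite_permutations) simp
  show "finite (point_stabilizer n)"
    by (rule finite_subset[OF _ fin]) (auto simp: mem_point_stabilizer)
  show "finite (cyclic_subgroup n)"
    by (rule finite_subset[OF _ fin]) (use cyclic_subgroup_permutes in blast)
  have id: "id \<in> cyclic_subgroup n"
    using subgroup.one_closed[OF subgroup_cyclic_subgroup[of n]] by (simp add: sym_group_one)
  then show "point_stabilizer n \<inter> cyclic_subgroup n = {\<one>\<^bsub>sym_group n\<^esub>}"
    using cyclic_subgroup_eqI[OF _ id] by (auto simp: mem_point_stabilizer sym_group_one permutes_id)
  fix g assume "g \<in> carrier (sym_group n)"
  then have g: "g permutes {1..n}" by (simp add: sym_group_carrier)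
  then have "inv' g n \<in> {1..n}"
    using permutes_in_image[OF permutes_inv[OF g], of n] assms by simp
  then obtain y where y: "y \<in> cyclic_subgroup n" "y n = inv' g n"
    using cyclic_subgroup_transitive by blast
  have yp: "y permutes {1..n}" using y(1) by (rule cyclic_subgroup_permutes)
  have "g \<circ> y \<in> point_stabilizer n"
    using g y(2) permutes_compose[OF yp g] by (simp add: mem_point_stabilizer permutes_inverses)
  moreover have "inv' y \<in> cyclic_subgroup n"
    using subgroup.m_inv_closed[OF subgroup_cyclic_subgroup y(1)] yp by (simp add: sym_group_carrier)
  moreover have "g = (g \<circ> y) \<circ> inv' y"
    using permutes_inv_o(1)[OF yp] by (simp add: comp_assoc)
  ultimately show "\<exists>a\<in>point_stabilizer n. \<exists>x\<in>cyclic_subgroup n. g = a \<otimes>\<^bsub>sym_group n\<^esub> x"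
    by (auto simp: sym_group_mult)
qed

section \<open>Indicators of simple modules for the factorized symmetric group\<close>

locale simple_sym_module =
  simple_bismash_module "sym_group n" "point_stabilizer n" "cyclic_subgroup n" scale act
  for n :: nat
    and scale :: "'k::{alg_closed_field, field_char_0} \<Rightarrow> 'v::ab_group_add \<Rightarrow> 'v" (infixr \<open>*s\<close> 75)
    and act :: "((nat \<Rightarrow> nat) \<times> (nat \<Rightarrow> nat) \<Rightarrow> 'k) \<Rightarrow> 'v \<Rightarrow> 'v" +
  assumes n_ge_2: "n \<ge> 2"
begin

lemma n_in: "n \<in> {1..n}" using n_ge_2 by simp

lemma sym_inv: "x \<in> cyclic_subgroup n \<Longrightarrow> inv\<^bsub>sym_group n\<^esub> x = inv' x"
  using cyclic_subgroup_permutes by (simp add: sym_group_carrier)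

lemma sym_inv_in: "x \<in> cyclic_subgroup n \<Longrightarrow> inv' x \<in> cyclic_subgroup n"
  using G_closed(2) sym_inv by metis

lemma inv_n_in: "x \<in> cyclic_subgroup n \<Longrightarrow> inv' x n \<in> {1..n}"
  using permutes_in_image[OF cyclic_subgroup_permutes[OF sym_inv_in], of x n] n_in by blast

lemma inv_n_eq_iff: "x \<in> cyclic_subgroup n \<Longrightarrow> inv' x n = n \<longleftrightarrow> x = id"
  using cyclic_subgroup_eqI[of x n id] G_closed(3) cyclic_subgroup_permutes[of x n]
  by (auto simp: sym_group_one permutes_inv_eq)

text \<open>Labelling \<open>x\<close> by the point \<open>inv' x n\<close> turns the right action
  into the natural action on points: \<open>a\<close> carries the label of \<open>x \<lhd> a\<close>
  to the label of \<open>x\<close>.\<close>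

lemma ract_eq_iff_point:
  assumes "x \<in> cyclic_subgroup n" "a \<in> point_stabilizer n" "z \<in> cyclic_subgroup n"
  shows "ract (sym_group n) (point_stabilizer n) (cyclic_subgroup n) x a = z \<longleftrightarrow>
    a (inv' z n) = inv' x n"
proof -
  note p = cyclic_subgroup_permutes[OF assms(1)] cyclic_subgroup_permutes[OF sym_inv_in[OF assms(3)]]
  have a: "a permutes {1..n}" using assms(2) by (simp add: mem_point_stabilizer)
  have "ract (sym_group n) (point_stabilizer n) (cyclic_subgroup n) x a = z \<longleftrightarrow>
      x \<circ> a \<circ> inv' z \<in> point_stabilizer n"
    using ract_eq_iff[OF assms] sym_inv[OF assms(3)] by (simp add: sym_group_mult)
  also have "\<dots> \<longleftrightarrow> x (a (inv' z n)) = n"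
    using permutes_compose[OF p(2) permutes_compose[OF a p(1)]] by (simp add: mem_point_stabilizer o_assoc)
  also have "\<dots> \<longleftrightarrow> a (inv' z n) = inv' x n"
    using permutes_inv_eq[OF p(1), of n] by (metis)
  finally show ?thesis .
qed

text \<open>The stabilizer of \<open>x\<close> in \<open>S\<^sub>n\<^sub>-\<^sub>1\<close> is the
  full symmetric group of this set. For \<open>x = id\<close> the two removed points
  coincide.\<close>

definition moved :: "(nat \<Rightarrow> nat) \<Rightarrow> nat set"
  where "moved x = {1..n} - {n, inv' x n}"

lemma finite_moved: "finite (moved x)"
  by (simp add: moved_def)

lemma permutes_moved_iff:
  assumes "x \<in> cyclic_subgroup n"
  shows "p permutes moved x \<longleftrightarrow> p \<in> point_stabilizer n \<and> p (inv' x n) = inv' x n"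
  unfolding moved_def using permutes_Diff_iff[OF n_in inv_n_in[OF assms]]
  by (auto simp: mem_point_stabilizer)

text \<open>On the stabilizer of \<open>x\<close> the delta in the product of basis elements is
  always 1, so the action is multiplicative; irreducibility is
  \<open>component_irreducible\<close>.\<close>

lemma irreducible_rep_component:
  assumes x: "x \<in> cyclic_subgroup n" and nz: "component x \<noteq> {0}"
  shows "irreducible_rep (*s) some_basis (perm_group (moved x)) (act_basis x) (component x)"
proof -
  have mem: "p \<in> point_stabilizer n \<and>
      ract (sym_group n) (point_stabilizer n) (cyclic_subgroup n) x p = x" if "p permutes moved x" for p
    using that x by (simp add: permutes_moved_iff ract_eq_iff_point)
  have "group_rep (*s) some_basis (perm_group (moved x)) (act_basis x) (component x)"
  proof (intro group_rep.intro group_rep_axioms.intro)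
    show "group (perm_group (moved x))" by (rule group_perm_group)
    show "finite (carrier (perm_group (moved x)))"
      using finite_permutations[OF finite_moved] by (simp add: carrier_perm_group)
    fix g h w assume g: "g \<in> carrier (perm_group (moved x))" and h: "h \<in> carrier (perm_group (moved x))"
    show "act_basis x (g \<otimes>\<^bsub>perm_group (moved x)\<^esub> h) w = act_basis x g (act_basis x h w)"
      using act_basis_mult[of x g x h w] mem[of g] mem[of h] g h x by (simp add: sym_group_mult)
  qed (use x mem endo_act_basis act_basis_in_component subspace_component fd_space_axioms in
      \<open>auto simp: component_def sym_group_one\<close>)
  then interpret C: group_rep "(*s)" some_basis "perm_group (moved x)" "act_basis x" "component x" .
  show ?thesis
  proof
    fix U assume U: "C.invariant U"
    show "U = {0} \<or> U = component x"
      using component_irreducible[OF x, of U] U ract_eq_iff_point[OF x _ x] permutes_moved_iff[OF x]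
      by (auto simp: C.invariant_def)
  qed (rule nz)
qed

text \<open>
  An element \<open>a\<close> of \<open>S\<^sub>n\<^sub>-\<^sub>1\<close> with \<open>y \<circ> a \<circ> y \<in> S\<^sub>n\<^sub>-\<^sub>1\<close> is one for which \<open>y \<circ> a\<close> exchanges \<open>n\<close> and
  \<open>j = y n\<close>. Hence \<open>y \<circ> a\<close> is the product of the commuting permutations \<open>(n j)\<close> and \<open>h\<close>, where
  \<open>h\<close> fixes \<open>n\<close> and \<open>j\<close>.
\<close>

lemma sum_square_reindex:
  assumes y: "y \<in> cyclic_subgroup n"
  shows "(\<Sum>a\<in>{a \<in> point_stabilizer n. y \<circ> a \<circ> y \<in> point_stabilizer n}. f (y \<circ> a \<circ> y \<circ> a)) =
    (\<Sum>h | h permutes moved (inv' y). f (h \<circ> h))"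
proof -
  define j where "j = y n"
  define t where "t = transpose n j"
  have yp: "y permutes {1..n}" using y by (rule cyclic_subgroup_permutes)
  have ip: "inv' y permutes {1..n}" using yp by (rule permutes_inv)
  have j: "j \<in> {1..n}" using permutes_in_image[OF yp, of n] n_in j_def by blast
  have tp: "t permutes {1..n}" unfolding t_def using n_in j by (rule permutes_swap_id)
  have tt: "t (t i) = i" for i by (simp add: t_def)
  have y_inv: "y (inv' y i) = i" "inv' y (y i) = i" for i using permutes_inverses[OF yp] by auto
  have moved_y: "h permutes moved (inv' y) \<longleftrightarrow> h permutes {1..n} \<and> h n = n \<and> h j = j" for h
    using permutes_moved_iff[OF sym_inv_in[OF y]] permutes_bij[OF yp]
    by (simp add: inv_inv_eq mem_point_stabilizer j_def conj_assoc)
  have fix_iff: "a \<in> point_stabilizer n \<and> y \<circ> a \<circ> y \<in> point_stabilizer n \<longleftrightarrow>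
      a permutes {1..n} \<and> a n = n \<and> y (a j) = n" for a
    using permutes_compose[OF yp permutes_compose[OF _ yp], of a]
    by (auto simp: mem_point_stabilizer j_def o_assoc)
  have commute: "t (h i) = h (t i)" if "h permutes {1..n}" "h n = n" "h j = j" for h i
    using that(2,3) permutes_inj[OF that(1)] by (auto simp: t_def transpose_def inj_eq)
  have square: "y \<circ> a \<circ> y \<circ> a = (t \<circ> y \<circ> a) \<circ> (t \<circ> y \<circ> a)"
    if a: "a permutes {1..n}" "a n = n" "y (a j) = n" for a
  proof -
    have h: "(t \<circ> y \<circ> a) permutes {1..n}" "(t \<circ> y \<circ> a) n = n" "(t \<circ> y \<circ> a) j = j"
      using a permutes_compose[OF a(1) permutes_compose[OF yp tp]]
      by (simp_all add: o_assoc t_def j_def)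
    have "y (a (y (a i))) = t (y (a (t (y (a i)))))" for i
      using commute[OF h, of "t (y (a i))"] commute[OF h, of "y (a i)"] by (simp add: tt)
    then show ?thesis by (simp add: fun_eq_iff)
  qed
  show ?thesis
  proof (rule sum.reindex_bij_witness[of _ "\<lambda>h. inv' y \<circ> t \<circ> h" "\<lambda>a. t \<circ> y \<circ> a"])
    fix a assume "a \<in> {a \<in> point_stabilizer n. y \<circ> a \<circ> y \<in> point_stabilizer n}"
    then have a: "a permutes {1..n}" "a n = n" "y (a j) = n" using fix_iff by auto
    show "inv' y \<circ> t \<circ> (t \<circ> y \<circ> a) = a" by (simp add: fun_eq_iff tt y_inv)
    show "t \<circ> y \<circ> a \<in> {h. h permutes moved (inv' y)}"
      using a permutes_compose[OF a(1) permutes_compose[OF yp tp]]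
      by (simp add: moved_y o_assoc) (simp add: t_def j_def)
    show "f ((t \<circ> y \<circ> a) \<circ> (t \<circ> y \<circ> a)) = f (y \<circ> a \<circ> y \<circ> a)" using square[OF a] by simp
  next
    fix h assume "h \<in> {h. h permutes moved (inv' y)}"
    then have h: "h permutes {1..n}" "h n = n" "h j = j" using moved_y by auto
    show "t \<circ> y \<circ> (inv' y \<circ> t \<circ> h) = h" by (simp add: fun_eq_iff tt y_inv)
    have "inv' y \<circ> t \<circ> h permutes {1..n}"
      using permutes_compose[OF h(1) permutes_compose[OF tp ip]] by (simp add: o_assoc)
    then show "inv' y \<circ> t \<circ> h \<in> {a \<in> point_stabilizer n. y \<circ> a \<circ> y \<in> point_stabilizer n}"
      using h fix_iff[of "inv' y \<circ> t \<circ> h"] y_inv by (simp add: t_def) (simp add: j_def y_inv)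
  qed
qed

lemma component_sum:
  assumes x: "x \<in> cyclic_subgroup n"
  shows "(\<Sum>h | h permutes moved x. trace_on (component x) (act_basis x (h \<circ> h))) =
    (if component x = {0} then 0 else of_nat (fact (card (moved x))))"
proof (cases "component x = {0}")
  case True
  have "trace_on (component x) (act_basis x (h \<circ> h)) = 0" if "h permutes moved x" for h
  proof -
    have hh: "h \<circ> h \<in> point_stabilizer n"
      using permutes_compose[OF that that] permutes_moved_iff[OF x] by blast
    \<comment> \<open>On the zero space the operator agrees with multiplication by 0, whose trace
      \<open>trace_on_scale\<close> evaluates.\<close>
    have "trace_on (component x) (act_basis x (h \<circ> h)) = trace_on {0} (\<lambda>v. 0 *s v)"
      unfolding True by (rule trace_on_cong) (use act_basis_zero[OF x hh] in auto)
    also have "\<dots> = 0"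
      using trace_on_scale[OF subspace_single_0, of "\<lambda>v. v" 0] linear_ident by simp
    finally show ?thesis .
  qed
  then show ?thesis using True by simp
next
  case False
  then show ?thesis
    using sum_trace_squares_perm_group[OF finite_moved irreducible_rep_component[OF x False]] by simp
qed

lemma card_moved:
  assumes "x \<in> cyclic_subgroup n"
  shows "card (moved x) = (if x = id then n - 1 else n - 2)"
  using inv_n_eq_iff[OF assms] inv_n_in[OF assms] n_in by (auto simp: moved_def card_Diff_subset)

text \<open>The numerator adds the stabilizer orders over all \<open>x\<close> with nonzero
  component. These form a single orbit, either the identity alone or all other elements, so the sum
  is the order of \<open>S\<^sub>n\<^sub>-\<^sub>1\<close>: \<open>(n - 1)!\<close> at once, or
  \<open>n - 1\<close> terms \<open>(n - 2)!\<close>.\<close>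

theorem fs_indicator_eq_1: "fs_indicator H (module_character (*s) act) = 1"
proof -
  let ?G = "cyclic_subgroup n"
  have id: "id \<in> ?G" using G_closed(3) by (simp add: sym_group_one)
  have "fs_indicator H (module_character (*s) act) =
      (\<Sum>y\<in>?G. if component (inv' y) = {0} then 0 else of_nat (fact (card (moved (inv' y))))) /
      of_nat (card (point_stabilizer n))"
    unfolding fs_indicator_eq sym_group_mult
    by (intro arg_cong2[of _ _ _ _ "(/)"] sum.cong refl)
      (simp add: sym_inv sum_square_reindex[of _ "\<lambda>g. trace_on (component _) (act_basis _ g)"]
        component_sum sym_inv_in)
  also have "(\<Sum>y\<in>?G. if component (inv' y) = {0} then 0 else of_nat (fact (card (moved (inv' y))))) =
      (\<Sum>x\<in>?G. if component x = {0} then 0 else of_nat (fact (card (moved x))) :: 'k)"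
    by (rule sum.reindex_bij_witness[of _ inv' inv'])
      (auto simp: sym_inv_in inv_inv_eq permutes_bij[OF cyclic_subgroup_permutes])
  also have "\<dots> = of_nat (fact (n - 1))"
  proof (cases "component id = {0}")
    case False
    then have "component x = {0}" if "x \<in> ?G" "x \<noteq> id" for x
      using component_eq_0_if_component_one that by (simp add: sym_group_one)
    then have "(\<Sum>x\<in>?G. if component x = {0} then 0 else of_nat (fact (card (moved x))) :: 'k) =
        (\<Sum>x\<in>{id}. of_nat (fact (card (moved x))))"
      using id finite_G False by (intro sum.mono_neutral_cong_right) auto
    then show ?thesis using card_moved[OF id] by simp
  next
    case True
    have "component x \<noteq> {0}" if x: "x \<in> ?G" "x \<noteq> id" for x
    proof
      assume x0: "component x = {0}"
      obtain z where z: "z \<in> ?G" "component z \<noteq> {0}" using component_exists by blast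
      then have "z \<noteq> id" using True by auto
      \<comment> \<open>Neither label is \<open>n\<close>, so this transposition fixes
        \<open>n\<close>. It carries the label of \<open>z\<close> to that of \<open>x\<close>,
        whence \<open>z = x \<lhd> ?a\<close>, and the component of \<open>z\<close> would vanish
        with that of \<open>x\<close>.\<close>
      let ?a = "transpose (inv' z n) (inv' x n)"
      have "?a permutes {1..n}" using inv_n_in[OF z(1)] inv_n_in[OF x(1)] by (rule permutes_swap_id)
      then have "?a \<in> point_stabilizer n"
        using inv_n_eq_iff[OF z(1)] inv_n_eq_iff[OF x(1)] \<open>z \<noteq> id\<close> x(2)
        by (simp add: mem_point_stabilizer transpose_def)
      then show False
        using component_ract_eq_0[OF x(1) _ x0] ract_eq_iff_point[OF x(1) _ z(1)] z(2)
        by (metis transpose_apply_first)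
    qed
    then have "(\<Sum>x\<in>?G. if component x = {0} then 0 else of_nat (fact (card (moved x))) :: 'k) =
        (\<Sum>x\<in>?G - {id}. of_nat (fact (n - 2)))"
      using finite_G True card_moved by (intro sum.mono_neutral_cong_right) auto
    also have "\<dots> = of_nat ((n - 1) * fact (n - 2))"
      using id finite_G card_cyclic_subgroup[of n] n_ge_2 by simp
    also have "(n - 1) * fact (n - 2) = (fact (n - 1) :: nat)"
      using n_ge_2 fact_reduce[of "n - 1", where 'a = nat] by (simp add: numeral_2_eq_2)
    finally show ?thesis .
  qed
  finally show ?thesis using card_point_stabilizer[of n] n_ge_2 by simp
qed

end

theorem theorem3p6:
  fixes n :: nat
    and scale :: "'k::{alg_closed_field, field_char_0} \<Rightarrow> 'v::ab_group_add \<Rightarrow> 'v"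
    and act :: "((nat \<Rightarrow> nat) \<times> (nat \<Rightarrow> nat) \<Rightarrow> 'k) \<Rightarrow> 'v \<Rightarrow> 'v"
  assumes "n \<ge> 2"
    and "simple_hopf_module scale (bismash_sym n) act"
  shows "fs_indicator (bismash_sym n) (module_character scale act) = 1"
proof -
  have "simple_sym_module n scale act"
    using assms factorized_sym_group[of n]
    by (simp add: bismash_sym_def simple_sym_module_def simple_sym_module_axioms_def
        simple_bismash_module_def)
  then show ?thesis
    unfolding bismash_sym_def by (rule simple_sym_module.fs_indicator_eq_1)
qed

end
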